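(* Let $(g_t)_{t\ge0}$, $g_t\in(C^2_b(\mathbb R^d))^*$, be the solution of $$g_t(h) = -\alpha\int_0^t\Big[\int_{\mathcal X}\big(g_s(\varsigma_{x,u})-y\big)\,\mathcal K_\lambda(h,\varsigma_{x,u})\,\mu(dx,dz,dy,du)\Big]ds,\qquad g_0(h)=0,\qquad h\in C^2_b(\mathbb R^d),$$ where $\mathcal K_\lambda(h,\varsigma)=\int_{\mathbb R^d}[h(w)\varsigma(w)+\mu_{c^2}\nabla h(w)^\top\nabla\varsigma(w)]\lambda(dw)$ and $\mathcal X=\mathbb R^{d+d_z+2}$. Then $$\frac{d}{dt}\Big[\frac12\int_{\mathcal X}\big(g_t(\varsigma_{x,u})-y\big)^2\,\mu(dx,dz,dy,du)\Big]\le0 .$$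
   Context: $\varsigma_{x,u}(w)=\sigma(w^\top x+u)$ for $x\in\mathbb R^d$, $u\in\mathbb R$, $w\in\mathbb R^d$; $\alpha>0$, $\mu_{c^2}>0$ are constants. $C^2_b(\mathbb R^d)$ is the Banach space of $C^2$ functions with finite norm $\|h\|_{C^2}=\sup_x\max_{i,j,k}\{|h(x)|,|\partial_ih(x)|,|\partial_j\partial_kh(x)|\}$. Data. $(X_k,Z_k)_{k\ge0}$ is a time-homogeneous Markov chain in $\mathbb R^d\times\mathbb R^{d_z}$ with transition kernel $P$; $(\eta_k)_{k\ge0}$ are i.i.d. in $\mathbb R^{d_\eta}$, independent of $(X_k,Z_k)_{k\ge0}$; $Y_k=f(X_k,Z_k,\eta_k)\in\mathbb R$. Assumed: (i) there is $L<1$ with $\mathsf W_2(P((x,z),\cdot),P((\tilde x,\tilde z),\cdot))\le L|(x,z)-(\tilde x,\tilde z)|$ for all $(x,z),(\tilde x,\tilde z)$, where $\mathsf W_2$ is the 2-Wasserstein distance for the Euclidean norm; (ii) $|(X_k,Z_k)|\le C_x<\infty$; (iii) $\mathbb E|\eta_k|^2<\infty$; (iv) $f$ is bounded and Lipschitz. Memory. $\sigma\in C^2_b(\mathbb R)$ (bounded, twice continuously differentiable, bounded derivatives), $C_{\sigma'}=\sup|\sigma'|$; $\lambda(dw)$ is a probability measure on $\mathbb R^d$, absolutely continuous w.r.t. Lebesgue measure, with $\int|w|^2\lambda(dw)=\mu_{w^2}\in(0,\infty)$; $\mu_b\in(0,\infty)$ with $\mu_b\le K_b$, $2K_b^2C_{\sigma'}^2<1$;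 and $q_0:=\sqrt{\max\{L^2+2\mu_b^2\mu_{w^2}C_{\sigma'}^2,\;2\mu_b^2C_{\sigma'}^2\}}<1$. Set $u_0=0$, $u_{k+1}=\mu_b\int\sigma(w^\top X_k+u_k)\lambda(dw)$ and $H_k=(X_k,Z_k,Y_k,u_k)$. $(H_k)$ is a Markov chain and $\mu$ is its unique stationary distribution (the $\mathsf W_2$-limit of the law of $H_k$ from any initial law with finite second moment); it has bounded support. *)

theory Defs
  imports "HOL-Probability.Probability"
begin

text \<open>The partial derivative in the coordinate direction \<open>i \<in> Basis\<close>; only used where \<open>h\<close> is
  (Frechet) differentiable.\<close>

definition partial_deriv :: "'a::euclidean_space \<Rightarrow> ('a \<Rightarrow> real) \<Rightarrow> 'a \<Rightarrow> real" where
  "partial_deriv i h x = frechet_derivative h (at x) i"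

definition C2 :: "('a::euclidean_space \<Rightarrow> real) set" where
  "C2 = {h. (\<forall>x. h differentiable at x) \<and>
            (\<forall>i\<in>Basis. \<forall>x. partial_deriv i h differentiable at x) \<and>
            (\<forall>i\<in>Basis. \<forall>j\<in>Basis. continuous_on UNIV (partial_deriv j (partial_deriv i h)))}"

definition c2_jet :: "('a::euclidean_space \<Rightarrow> real) \<Rightarrow> 'a \<Rightarrow> real set" where
  "c2_jet h x = insert \<bar>h x\<bar>
     ((\<lambda>i. \<bar>partial_deriv i h x\<bar>) ` Basis \<union>
      (\<lambda>(j, k). \<bar>partial_deriv j (partial_deriv k h) x\<bar>) ` (Basis \<times> Basis))"

definition c2_norm :: "('a::euclidean_space \<Rightarrow> real) \<Rightarrow> real" where
  "c2_norm h = (SUP x. Max (c2_jet h x))"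

definition C2b :: "('a::euclidean_space \<Rightarrow> real) set" where
  "C2b = {h \<in> C2. bdd_above (range (\<lambda>x. Max (c2_jet h x)))}"

lemma partial_deriv_0 [simp]: "partial_deriv i (\<lambda>x. 0) = (\<lambda>x. 0)"
  by (simp add: partial_deriv_def fun_eq_iff)

lemma partial_deriv_add:
  assumes "\<And>x. f differentiable at x" "\<And>x. g differentiable at x"
  shows "partial_deriv i (\<lambda>x. f x + g x) = (\<lambda>x. partial_deriv i f x + partial_deriv i g x)"
proof
  fix x
  have "((\<lambda>x. f x + g x) has_derivative
      (\<lambda>v. frechet_derivative f (at x) v + frechet_derivative g (at x) v)) (at x)"
    using assms by (intro has_derivative_add) (simp_all add: frechet_derivative_works[symmetric])
  from frechet_derivative_at[OF this]
  show "partial_deriv i (\<lambda>x. f x + g x) x = partial_deriv i f x + partial_deriv i g x"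
    by (metis partial_deriv_def)
qed

lemma partial_deriv_scale:
  assumes "\<And>x. f differentiable at x"
  shows "partial_deriv i (\<lambda>x. c * f x) = (\<lambda>x. c * partial_deriv i f x)"
proof
  fix x
  have "((\<lambda>x. c * f x) has_derivative (\<lambda>v. c * frechet_derivative f (at x) v)) (at x)"
    using assms by (intro has_derivative_mult_right) (simp add: frechet_derivative_works[symmetric])
  from frechet_derivative_at[OF this]
  show "partial_deriv i (\<lambda>x. c * f x) x = c * partial_deriv i f x"
    by (metis partial_deriv_def)
qed

lemma finite_c2_jet [simp]: "finite (c2_jet h x)"
  and c2_jet_nonempty [simp]: "c2_jet h x \<noteq> {}"
  by (simp_all add: c2_jet_def)

lemma Max_c2_jet_le_iff:
  "Max (c2_jet h x) \<le> c \<longleftrightarrow> \<bar>h x\<bar> \<le> c \<and> (\<forall>i\<in>Basis. \<bar>partial_deriv i h x\<bar> \<le> c) \<and>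
     (\<forall>j\<in>Basis. \<forall>k\<in>Basis. \<bar>partial_deriv j (partial_deriv k h) x\<bar> \<le> c)"
  by (subst Max_le_iff) (auto simp: c2_jet_def)

lemma Max_c2_jet_add:
  assumes "f \<in> C2" "g \<in> C2"
  shows "Max (c2_jet (\<lambda>x. f x + g x) x) \<le> Max (c2_jet f x) + Max (c2_jet g x)"
proof -
  have 1: "partial_deriv i (\<lambda>x. f x + g x) = (\<lambda>x. partial_deriv i f x + partial_deriv i g x)" for i
    using assms by (intro partial_deriv_add) (auto simp: C2_def)
  have 2: "partial_deriv j (\<lambda>x. partial_deriv i f x + partial_deriv i g x) =
      (\<lambda>x. partial_deriv j (partial_deriv i f) x + partial_deriv j (partial_deriv i g) x)"
    if "i \<in> Basis" for i j
    using assms that by (intro partial_deriv_add) (auto simp: C2_def)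
  have f: "Max (c2_jet f x) \<le> Max (c2_jet f x)" and g: "Max (c2_jet g x) \<le> Max (c2_jet g x)"
    by simp_all
  show ?thesis
    unfolding Max_c2_jet_le_iff[of "\<lambda>x. f x + g x"]
    using f[unfolded Max_c2_jet_le_iff[of f x]] g[unfolded Max_c2_jet_le_iff[of g x]]
    by (auto simp: 1 2 intro!: order_trans[OF abs_triangle_ineq] add_mono)
qed

lemma Max_c2_jet_scale_le:
  assumes "f \<in> C2"
  shows "Max (c2_jet (\<lambda>x. c * f x) x) \<le> \<bar>c\<bar> * Max (c2_jet f x)"
proof -
  have 1: "partial_deriv i (\<lambda>x. c * f x) = (\<lambda>x. c * partial_deriv i f x)" for i
    using assms by (intro partial_deriv_scale) (auto simp: C2_def)
  have 2: "partial_deriv j (\<lambda>x. c * partial_deriv i f x) =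
      (\<lambda>x. c * partial_deriv j (partial_deriv i f) x)" if "i \<in> Basis" for i j
    using assms that by (intro partial_deriv_scale) (auto simp: C2_def)
  have f: "Max (c2_jet f x) \<le> Max (c2_jet f x)" by simp
  show ?thesis
    unfolding Max_c2_jet_le_iff[of "\<lambda>x. c * f x"]
    using f[unfolded Max_c2_jet_le_iff[of f x]]
    by (auto simp: 1 2 abs_mult intro!: mult_left_mono)
qed

lemma C2_0: "(\<lambda>x. 0) \<in> C2"
  by (simp add: C2_def)

lemma C2_add:
  assumes "f \<in> C2" "g \<in> C2"
  shows "(\<lambda>x. f x + g x) \<in> C2"
proof -
  have 1: "partial_deriv i (\<lambda>x. f x + g x) = (\<lambda>x. partial_deriv i f x + partial_deriv i g x)" for i
    using assms by (intro partial_deriv_add) (auto simp: C2_def)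
  have 2: "partial_deriv j (\<lambda>x. partial_deriv i f x + partial_deriv i g x) =
      (\<lambda>x. partial_deriv j (partial_deriv i f) x + partial_deriv j (partial_deriv i g) x)"
    if "i \<in> Basis" for i j
    using assms that by (intro partial_deriv_add) (auto simp: C2_def)
  show ?thesis
    using assms by (auto simp: C2_def 1 2 intro!: differentiable_add continuous_on_add)
qed

lemma C2_scale:
  assumes "f \<in> C2"
  shows "(\<lambda>x. c * f x) \<in> C2"
proof -
  have 1: "partial_deriv i (\<lambda>x. c * f x) = (\<lambda>x. c * partial_deriv i f x)" for i
    using assms by (intro partial_deriv_scale) (auto simp: C2_def)
  have 2: "partial_deriv j (\<lambda>x. c * partial_deriv i f x) =
      (\<lambda>x. c * partial_deriv j (partial_deriv i f) x)" if "i \<in> Basis" for i j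
    using assms that by (intro partial_deriv_scale) (auto simp: C2_def)
  show ?thesis
    using assms by (auto simp: C2_def 1 2 intro!: differentiable_mult continuous_on_mult)
qed

lemma Max_c2_jet_le_c2_norm: "h \<in> C2b \<Longrightarrow> Max (c2_jet h x) \<le> c2_norm h"
  unfolding c2_norm_def C2b_def by (rule cSUP_upper) auto

lemma c2_norm_le: "(\<And>x. Max (c2_jet h x) \<le> c) \<Longrightarrow> c2_norm h \<le> c"
  unfolding c2_norm_def by (rule cSUP_least) auto

lemma C2bI: "h \<in> C2 \<Longrightarrow> (\<And>x. Max (c2_jet h x) \<le> c) \<Longrightarrow> h \<in> C2b"
  unfolding C2b_def by (auto intro!: bdd_aboveI2[where M = c])

lemma C2b_0: "(\<lambda>x. 0) \<in> C2b"
  by (rule C2bI[OF C2_0, where c = 0]) (simp add: Max_c2_jet_le_iff)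

lemma C2bD: "h \<in> C2b \<Longrightarrow> h \<in> C2"
  by (simp add: C2b_def)

lemma Max_c2_jet_add_le_c2_norm:
  assumes "f \<in> C2b" "g \<in> C2b"
  shows "Max (c2_jet (\<lambda>x. f x + g x) x) \<le> c2_norm f + c2_norm g"
  using Max_c2_jet_add[OF assms[THEN C2bD], of x]
    assms[THEN Max_c2_jet_le_c2_norm, of x] by linarith

lemma Max_c2_jet_scale_le_c2_norm:
  assumes "f \<in> C2b"
  shows "Max (c2_jet (\<lambda>x. c * f x) x) \<le> \<bar>c\<bar> * c2_norm f"
  using Max_c2_jet_scale_le[OF C2bD[OF assms], of c x]
    mult_left_mono[OF Max_c2_jet_le_c2_norm[OF assms, of x], of "\<bar>c\<bar>"] by linarith

lemma C2b_add: "f \<in> C2b \<Longrightarrow> g \<in> C2b \<Longrightarrow> (\<lambda>x. f x + g x) \<in> C2b"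
  by (rule C2bI[OF C2_add Max_c2_jet_add_le_c2_norm]) (auto dest: C2bD)

lemma C2b_scale: "f \<in> C2b \<Longrightarrow> (\<lambda>x. c * f x) \<in> C2b"
  by (rule C2bI[OF C2_scale Max_c2_jet_scale_le_c2_norm]) (auto dest: C2bD)

lemma C2b_minus: "f \<in> C2b \<Longrightarrow> (\<lambda>x. - f x) \<in> C2b"
  using C2b_scale[of f "-1"] by simp

lemma C2b_diff: "f \<in> C2b \<Longrightarrow> g \<in> C2b \<Longrightarrow> (\<lambda>x. f x - g x) \<in> C2b"
  using C2b_add[OF _ C2b_minus, of f g] by simp

lemma c2_norm_0: "c2_norm (\<lambda>x. 0) = 0"
proof -
  have "Max (c2_jet (\<lambda>x::'a. 0) x) = 0" for x
    by (rule antisym) (auto simp: Max_c2_jet_le_iff intro!: Max_ge simp: c2_jet_def)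
  then show ?thesis by (simp add: c2_norm_def)
qed

lemma c2_norm_triangle: "f \<in> C2b \<Longrightarrow> g \<in> C2b \<Longrightarrow> c2_norm (\<lambda>x. f x + g x) \<le> c2_norm f + c2_norm g"
  by (rule c2_norm_le) (rule Max_c2_jet_add_le_c2_norm)

lemma c2_norm_scale_le: "f \<in> C2b \<Longrightarrow> c2_norm (\<lambda>x. c * f x) \<le> \<bar>c\<bar> * c2_norm f"
  by (rule c2_norm_le) (rule Max_c2_jet_scale_le_c2_norm)

lemma c2_norm_scale:
  assumes "f \<in> C2b" shows "c2_norm (\<lambda>x. c * f x) = \<bar>c\<bar> * c2_norm f"
proof (cases "c = 0")
  case False
  have "c2_norm f \<le> \<bar>inverse c\<bar> * c2_norm (\<lambda>x. c * f x)"
    using c2_norm_scale_le[OF C2b_scale[OF assms, of c], of "inverse c"] False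
    by (simp add: mult.assoc[symmetric])
  then have "\<bar>c\<bar> * c2_norm f \<le> c2_norm (\<lambda>x. c * f x)"
    using False by (simp add: field_simps abs_inverse)
  with c2_norm_scale_le[OF assms, of c] show ?thesis by linarith
qed (simp add: c2_norm_0)

lemma c2_norm_eq_0D: "f \<in> C2b \<Longrightarrow> c2_norm f = 0 \<Longrightarrow> f = (\<lambda>x. 0)"
  using Max_c2_jet_le_c2_norm[of f] by (auto simp: Max_c2_jet_le_iff fun_eq_iff)

typedef (overloaded) 'a c2b = "C2b :: ('a::euclidean_space \<Rightarrow> real) set"
  morphisms apply_c2b Abs_c2b
  using C2b_0 by blast

setup_lifting type_definition_c2b

instantiation c2b :: (euclidean_space) real_vector
begin

lift_definition zero_c2b :: "'a c2b" is "\<lambda>x. 0" by (rule C2b_0)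
lift_definition plus_c2b :: "'a c2b \<Rightarrow> 'a c2b \<Rightarrow> 'a c2b" is "\<lambda>f g x. f x + g x" by (rule C2b_add)
lift_definition uminus_c2b :: "'a c2b \<Rightarrow> 'a c2b" is "\<lambda>f x. - f x" by (rule C2b_minus)
lift_definition minus_c2b :: "'a c2b \<Rightarrow> 'a c2b \<Rightarrow> 'a c2b" is "\<lambda>f g x. f x - g x" by (rule C2b_diff)
lift_definition scaleR_c2b :: "real \<Rightarrow> 'a c2b \<Rightarrow> 'a c2b" is "\<lambda>c f x. c * f x" by (rule C2b_scale)

instance
proof
  fix f g h :: "'a c2b" and a b :: real
  show "f + g + h = f + (g + h)" by transfer (simp add: add.assoc)
  show "f + g = g + f" by transfer (simp add: add.commute)
  show "0 + f = f" by transfer simp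
  show "- f + f = 0" by transfer simp
  show "f - g = f + - g" by transfer simp
  show "a *\<^sub>R (f + g) = a *\<^sub>R f + a *\<^sub>R g" by transfer (simp add: algebra_simps)
  show "(a + b) *\<^sub>R f = a *\<^sub>R f + b *\<^sub>R f" by transfer (simp add: algebra_simps)
  show "a *\<^sub>R b *\<^sub>R f = (a * b) *\<^sub>R f" by transfer (simp add: algebra_simps)
  show "1 *\<^sub>R f = f" by transfer simp
qed

end

instantiation c2b :: (euclidean_space) real_normed_vector
begin

lift_definition norm_c2b :: "'a c2b \<Rightarrow> real" is c2_norm .

definition dist_c2b :: "'a c2b \<Rightarrow> 'a c2b \<Rightarrow> real" where "dist_c2b f g = norm (f - g)"
definition sgn_c2b :: "'a c2b \<Rightarrow> 'a c2b" where "sgn_c2b f = f /\<^sub>R norm f"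
definition uniformity_c2b :: "('a c2b \<times> 'a c2b) filter" where
  "uniformity_c2b = (INF e\<in>{0<..}. principal {(x, y). dist x y < e})"
definition open_c2b :: "'a c2b set \<Rightarrow> bool" where
  "open_c2b U = (\<forall>x\<in>U. \<forall>\<^sub>F (x', y) in uniformity. x' = x \<longrightarrow> y \<in> U)"

instance
proof
  fix f g :: "'a c2b" and a :: real and U :: "'a c2b set"
  show "dist f g = norm (f - g)" by (rule dist_c2b_def)
  show "sgn f = f /\<^sub>R norm f" by (rule sgn_c2b_def)
  show "uniformity = (INF e\<in>{0<..}. principal {(x, y::'a c2b). dist x y < e})"
    by (rule uniformity_c2b_def)
  show "open U = (\<forall>x\<in>U. \<forall>\<^sub>F (x', y) in uniformity. x' = x \<longrightarrow> y \<in> U)"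
    by (rule open_c2b_def)
  show "norm f = 0 \<longleftrightarrow> f = 0" by transfer (auto simp: c2_norm_0 dest: c2_norm_eq_0D)
  show "norm (f + g) \<le> norm f + norm g" by transfer (rule c2_norm_triangle)
  show "norm (a *\<^sub>R f) = \<bar>a\<bar> * norm f" by transfer (rule c2_norm_scale)
qed

end

definition grad :: "('a::euclidean_space \<Rightarrow> real) \<Rightarrow> 'a \<Rightarrow> 'a" where
  "grad h w = (\<Sum>i\<in>Basis. partial_deriv i h w *\<^sub>R i)"

definition couplings :: "'a::euclidean_space measure \<Rightarrow> 'a measure \<Rightarrow> ('a \<times> 'a) measure set" where
  "couplings \<mu> \<nu> = {\<gamma>. sets \<gamma> = sets borel \<and> distr \<gamma> borel fst = \<mu> \<and> distr \<gamma> borel snd = \<nu>}"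

definition ennreal_sqrt :: "ennreal \<Rightarrow> ennreal" where
  "ennreal_sqrt a = (if a = \<infinity> then \<infinity> else ennreal (sqrt (enn2real a)))"

text \<open>Extended-valued, so that an infinite transport cost is not confused with cost \<open>0\<close>.\<close>

definition wasserstein2 :: "'a::euclidean_space measure \<Rightarrow> 'a measure \<Rightarrow> ennreal" where
  "wasserstein2 \<mu> \<nu> =
     ennreal_sqrt (INF \<gamma>\<in>couplings \<mu> \<nu>. \<integral>\<^sup>+ (x, y). ennreal ((dist x y)\<^sup>2) \<partial>\<gamma>)"

definition history_algebra :: "'w measure \<Rightarrow> 'b measure \<Rightarrow> (nat \<Rightarrow> 'w \<Rightarrow> 'b) \<Rightarrow> nat \<Rightarrow> 'w measure" where
  "history_algebra M N S k =
     vimage_algebra (space M) (\<lambda>\<omega>. \<lambda>i\<in>{..k}. S i \<omega>) (Pi\<^sub>M {..k} (\<lambda>_. N))"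

definition path_events :: "'w measure \<Rightarrow> 'b measure \<Rightarrow> (nat \<Rightarrow> 'w \<Rightarrow> 'b) \<Rightarrow> 'w set set" where
  "path_events M N S = sets (vimage_algebra (space M) (\<lambda>\<omega> k. S k \<omega>) (Pi\<^sub>M UNIV (\<lambda>_. N)))"

definition markov_chain ::
  "'w measure \<Rightarrow> 'b measure \<Rightarrow> (nat \<Rightarrow> 'w \<Rightarrow> 'b) \<Rightarrow> ('b \<Rightarrow> 'b measure) \<Rightarrow> bool" where
  "markov_chain M N S P \<longleftrightarrow>
     (\<forall>k. S k \<in> M \<rightarrow>\<^sub>M N) \<and> P \<in> N \<rightarrow>\<^sub>M prob_algebra N \<and>
     (\<forall>k. \<forall>B\<in>sets N. AE \<omega> in M.
        real_cond_exp M (history_algebra M N S k) (\<lambda>\<omega>. indicator B (S (Suc k) \<omega>)) \<omega>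
          = measure (P (S k \<omega>)) B)"

definition stationary_distribution :: "'b measure \<Rightarrow> ('b \<Rightarrow> 'b measure) \<Rightarrow> 'b measure \<Rightarrow> bool" where
  "stationary_distribution N P \<mu> \<longleftrightarrow> \<mu> \<in> space (prob_algebra N) \<and> \<mu> \<bind> P = \<mu>"

definition memory_update :: "real \<Rightarrow> (real \<Rightarrow> real) \<Rightarrow> 'a::euclidean_space measure \<Rightarrow> 'a \<Rightarrow> real \<Rightarrow> real" where
  "memory_update \<mu>b \<sigma> lam x u = \<mu>b * (\<integral>w. \<sigma> (w \<bullet> x + u) \<partial>lam)"

text \<open>Transition kernel of \<open>H\<^sub>k = (X\<^sub>k, Z\<^sub>k, Y\<^sub>k, u\<^sub>k)\<close>, where \<open>\<nu>\<close> is the common law of the noise: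
  the next output uses the \<^emph>\<open>new\<close> input and fresh noise, the next memory the \<^emph>\<open>old\<close> input.\<close>

definition memory_kernel ::
  "('a::euclidean_space \<times> 'b::euclidean_space \<Rightarrow> ('a \<times> 'b) measure) \<Rightarrow> 'c::euclidean_space measure \<Rightarrow>
   ('a \<times> 'b \<times> 'c \<Rightarrow> real) \<Rightarrow> real \<Rightarrow> (real \<Rightarrow> real) \<Rightarrow> 'a measure \<Rightarrow>
   'a \<times> 'b \<times> real \<times> real \<Rightarrow> ('a \<times> 'b \<times> real \<times> real) measure" where
  "memory_kernel P \<nu> f \<mu>b \<sigma> lam = (\<lambda>(x, z, y, u).
     distr (P (x, z) \<Otimes>\<^sub>M \<nu>) borel
       (\<lambda>((x', z'), e). (x', z', f (x', z', e), memory_update \<mu>b \<sigma> lam x u)))"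

definition ridge :: "(real \<Rightarrow> real) \<Rightarrow> 'a::euclidean_space \<Rightarrow> real \<Rightarrow> 'a c2b" where
  "ridge \<sigma> x u = Abs_c2b (\<lambda>w. \<sigma> (w \<bullet> x + u))"

lemma partial_deriv_ridge:
  assumes "\<And>t. \<sigma> differentiable at t"
  shows "partial_deriv i (\<lambda>w. c * \<sigma> (w \<bullet> x + u)) = (\<lambda>w. c * (i \<bullet> x) * partial_deriv 1 \<sigma> (w \<bullet> x + u))"
proof
  fix w
  let ?D = "frechet_derivative \<sigma> (at (w \<bullet> x + u))"
  have D: "(\<sigma> has_derivative ?D) (at (w \<bullet> x + u))"
    using assms frechet_derivative_works by blast
  have "((\<lambda>w. c * \<sigma> (w \<bullet> x + u)) has_derivative (\<lambda>v. c * ?D (v \<bullet> x))) (at w)"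
    by (intro has_derivative_mult_right has_derivative_compose[of "\<lambda>w. w \<bullet> x + u", OF _ D])
      (auto intro!: derivative_eq_intros)
  from frechet_derivative_at[OF this]
  have "partial_deriv i (\<lambda>w. c * \<sigma> (w \<bullet> x + u)) w = c * ?D (i \<bullet> x)"
    by (metis partial_deriv_def)
  also have "?D (i \<bullet> x) = (i \<bullet> x) * ?D 1"
    using linear_scale[OF has_derivative_linear[OF D], of "i \<bullet> x" 1] by simp
  finally show "partial_deriv i (\<lambda>w. c * \<sigma> (w \<bullet> x + u)) w
      = c * (i \<bullet> x) * partial_deriv 1 \<sigma> (w \<bullet> x + u)"
    by (simp add: partial_deriv_def)
qed

lemma ridge_in_C2b:
  fixes x :: "'a::euclidean_space"
  assumes "\<sigma> \<in> C2b"
  shows "(\<lambda>w. \<sigma> (w \<bullet> x + u)) \<in> C2b"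
proof -
  let ?r = "\<lambda>w. \<sigma> (w \<bullet> x + u)"
  let ?d1 = "partial_deriv 1 \<sigma>" and ?d2 = "partial_deriv 1 (partial_deriv 1 \<sigma>)"
  have \<sigma>: "\<sigma> differentiable at t" "?d1 differentiable at t" "continuous_on UNIV ?d2" for t
    using assms by (auto simp: C2b_def C2_def)
  have b: "\<bar>\<sigma> t\<bar> \<le> c2_norm \<sigma>" "\<bar>?d1 t\<bar> \<le> c2_norm \<sigma>" "\<bar>?d2 t\<bar> \<le> c2_norm \<sigma>" for t
    using Max_c2_jet_le_c2_norm[OF assms, of t] by (auto simp: Max_c2_jet_le_iff)
  have 1: "partial_deriv i ?r = (\<lambda>w. (i \<bullet> x) * ?d1 (w \<bullet> x + u))" for i
    using partial_deriv_ridge[of \<sigma> i 1 x u] \<sigma>(1) by simp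
  have 2: "partial_deriv j (\<lambda>w. (i \<bullet> x) * ?d1 (w \<bullet> x + u))
      = (\<lambda>w. (i \<bullet> x) * (j \<bullet> x) * ?d2 (w \<bullet> x + u))" for i j
    using partial_deriv_ridge[of ?d1 j "i \<bullet> x" x u] \<sigma>(2) by simp
  have diff: "(\<lambda>w. h (w \<bullet> x + u)) differentiable at w" if "\<And>t. h differentiable at t"
    for h :: "real \<Rightarrow> real" and w
    by (rule differentiable_compose[of h]) (use that in \<open>auto intro!: derivative_intros\<close>)
  have c: "continuous_on UNIV (\<lambda>w. ?d2 (w \<bullet> x + u))"
    by (rule continuous_on_compose2[OF \<sigma>(3)]) (auto intro!: continuous_intros)
  have "?r \<in> C2"
    using \<sigma>(1,2) by (auto simp: C2_def 1 2 intro!: diff differentiable_mult continuous_on_mult c)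
  moreover have "Max (c2_jet ?r w) \<le> (1 + norm x)\<^sup>2 * c2_norm \<sigma>" for w
  proof -
    have n: "0 \<le> c2_norm \<sigma>" using b(1)[of 0] by linarith
    have i: "\<bar>i \<bullet> x\<bar> \<le> norm x" if "i \<in> Basis" for i :: 'a
      using Cauchy_Schwarz_ineq2[of i x] that by simp
    have s: "1 \<le> (1 + norm x)\<^sup>2" "norm x \<le> (1 + norm x)\<^sup>2" "norm x * norm x \<le> (1 + norm x)\<^sup>2"
      by (auto simp: power2_eq_square algebra_simps add_nonneg_nonneg)
    have m: "\<bar>a * t\<bar> \<le> (1 + norm x)\<^sup>2 * c2_norm \<sigma>"
      if "\<bar>a\<bar> \<le> (1 + norm x)\<^sup>2" "\<bar>t\<bar> \<le> c2_norm \<sigma>" for a t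
      using that n by (auto simp: abs_mult intro!: mult_mono)
    have ij: "\<bar>(i \<bullet> x) * (j \<bullet> x)\<bar> \<le> (1 + norm x)\<^sup>2" if "i \<in> Basis" "j \<in> Basis" for i j
      using s(3) mult_mono[OF i[OF that(1)] i[OF that(2)]] by (simp add: abs_mult)
    show ?thesis
      unfolding Max_c2_jet_le_iff 1 2
      using m[of 1, OF _ b(1)] m[OF order_trans[OF i s(2)] b(2)] m[OF ij b(3)] s(1)
      by (auto simp: 2)
  qed
  ultimately show ?thesis by (rule C2bI)
qed

lemma apply_ridge: "\<sigma> \<in> C2b \<Longrightarrow> apply_c2b (ridge \<sigma> x u) = (\<lambda>w. \<sigma> (w \<bullet> x + u))"
  unfolding ridge_def by (rule Abs_c2b_inverse) (rule ridge_in_C2b)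

definition kernel_K :: "real \<Rightarrow> 'a::euclidean_space measure \<Rightarrow> 'a c2b \<Rightarrow> 'a c2b \<Rightarrow> real" where
  "kernel_K \<mu>c2 lam h s =
     (\<integral>w. apply_c2b h w * apply_c2b s w
          + \<mu>c2 * (grad (apply_c2b h) w \<bullet> grad (apply_c2b s) w) \<partial>lam)"

definition flow_integrand :: "real \<Rightarrow> 'a::euclidean_space measure \<Rightarrow> (real \<Rightarrow> real) \<Rightarrow>
    ('a c2b \<Rightarrow>\<^sub>L real) \<Rightarrow> 'a c2b \<Rightarrow> 'a \<times> 'b \<times> real \<times> real \<Rightarrow> real" where
  "flow_integrand \<mu>c2 lam \<sigma> \<phi> h = (\<lambda>(x, z, y, u).
     (blinfun_apply \<phi> (ridge \<sigma> x u) - y) * kernel_K \<mu>c2 lam h (ridge \<sigma> x u))"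

text \<open>The two integrability clauses say that the integrals in the equation exist (the Bochner
  integral of a non-integrable function is \<open>0\<close>). No continuity of \<open>g\<close> in time is required, and
  the values of \<open>g\<close> at negative times are irrelevant.\<close>

definition flow_solution :: "real \<Rightarrow> real \<Rightarrow> 'a::euclidean_space measure \<Rightarrow> (real \<Rightarrow> real) \<Rightarrow>
    ('a \<times> 'b::euclidean_space \<times> real \<times> real) measure \<Rightarrow> (real \<Rightarrow> 'a c2b \<Rightarrow>\<^sub>L real) \<Rightarrow> bool" where
  "flow_solution \<alpha> \<mu>c2 lam \<sigma> \<mu> g \<longleftrightarrow>
     (\<forall>h. blinfun_apply (g 0) h = 0) \<and>
     (\<forall>h. \<forall>s\<ge>0. integrable \<mu> (flow_integrand \<mu>c2 lam \<sigma> (g s) h)) \<and>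
     (\<forall>h. \<forall>t\<ge>0. set_integrable lborel {0..t}
        (\<lambda>s. \<integral>p. flow_integrand \<mu>c2 lam \<sigma> (g s) h p \<partial>\<mu>)) \<and>
     (\<forall>h. \<forall>t\<ge>0. blinfun_apply (g t) h =
        - \<alpha> * (LBINT s:{0..t}. (\<integral>p. flow_integrand \<mu>c2 lam \<sigma> (g s) h p \<partial>\<mu>)))"

end

theory Submission
  imports Defs
begin

text \<open>Everything is controlled by the seminorm \<open>N h = \<integral>(\<bar>h\<bar> + \<mu>c2 \<bar>\<nabla>h\<bar>) d\<lambda>\<close>, because
  \<open>\<bar>\<K>(h, \<sigma>\<^sub>p)\<bar> \<le> C N h\<close> for \<open>p = (x, z, y, u)\<close> with \<open>\<bar>x\<bar> \<le> Cx\<close>, where \<open>\<sigma>\<^sub>p\<close> is the ridge function of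
  \<open>(x, u)\<close>. The contraction property of \<open>P\<close> forces \<open>\<mu>\<close> onto \<open>\<bar>x\<bar> \<le> Cx\<close>, \<open>\<bar>y\<bar> \<le> sup \<bar>f\<bar>\<close>. Since \<open>C2b\<close>
  is complete, the principle of uniform boundedness gives \<open>sup \<parallel>g\<^sub>s\<parallel> < \<infinity>\<close> on compact time intervals,
  so the residual \<open>r\<^sub>s p = g\<^sub>s \<sigma>\<^sub>p - y\<close> is bounded there. The flow equation now bootstraps: \<open>g\<close> is
  Lipschitz in time with respect to \<open>N\<close>, hence so is its time derivative, and the loss is differentiable
  with derivative \<open>- \<alpha> \<integral>\<integral> r p r q \<K>(\<sigma>\<^sub>p, \<sigma>\<^sub>q) \<mu>(dp) \<mu>(dq)\<close>. By Fubini's theorem the double integral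
  equals \<open>\<integral> \<bar>\<integral> r p (\<sigma>\<^sub>p w, \<surd>\<mu>c2 \<nabla>\<sigma>\<^sub>p w) \<mu>(dp)\<bar>\<^sup>2 \<lambda>(dw) \<ge> 0\<close>.

  The map \<open>p \<mapsto> \<sigma>\<^sub>p\<close> is not continuous in the norm of \<open>C2b\<close>, only in \<open>N\<close>; measurability of \<open>r\<^sub>s\<close>
  therefore rests on the bound \<open>\<bar>g\<^sub>s h\<bar> \<le> C N h\<close>.\<close>

subsection \<open>Completeness and uniform boundedness\<close>

lemma has_derivative_grad:
  fixes h :: "'a::euclidean_space \<Rightarrow> real"
  assumes "h differentiable at x"
  shows "(h has_derivative (\<lambda>v. grad h x \<bullet> v)) (at x)"
proof -
  let ?D = "frechet_derivative h (at x)"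
  have D: "(h has_derivative ?D) (at x)"
    using assms frechet_derivative_works by blast
  have "?D v = grad h x \<bullet> v" for v
  proof -
    interpret bounded_linear ?D
      using D by (rule has_derivative_bounded_linear)
    have "?D v = ?D (\<Sum>i\<in>Basis. (v \<bullet> i) *\<^sub>R i)"
      by (simp only: euclidean_representation)
    also have "\<dots> = grad h x \<bullet> v"
      by (simp add: sum scaleR grad_def partial_deriv_def inner_sum_left inner_sum_right
          inner_commute mult.commute)
    finally show ?thesis .
  qed
  then have "?D = (\<lambda>v. grad h x \<bullet> v)" ..
  with D show ?thesis by simp
qed

text \<open>Uniform convergence of the finitely many partial derivatives makes the total derivatives
  converge uniformly, so a sequence may be differentiated term by term. \<open>C2b_complete\<close>
  applies this twice: to the functions and to their first partial derivatives.\<close>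

lemma partial_deriv_uniform_limit:
  fixes F :: "nat \<Rightarrow> 'a::euclidean_space \<Rightarrow> real"
  assumes diff: "\<And>n x. F n differentiable at x"
    and lim: "\<And>x. (\<lambda>n. F n x) \<longlonglongrightarrow> f x"
    and unif: "\<And>i. i \<in> Basis \<Longrightarrow> uniform_limit UNIV (\<lambda>n. partial_deriv i (F n)) (G i) sequentially"
  shows "f differentiable at x" "i \<in> Basis \<Longrightarrow> partial_deriv i f = G i"
proof -
  define g' where "g' x v = (\<Sum>i\<in>Basis. G i x *\<^sub>R i) \<bullet> v" for x v :: 'a
  have "\<exists>g. \<forall>x\<in>UNIV. (\<lambda>n. F n x) \<longlonglongrightarrow> g x \<and> (g has_derivative g' x) (at x within UNIV)"
  proof (rule has_derivative_sequence)
    fix e :: real assume e: "e > 0"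
    \<comment> \<open>The gradient error is a sum over \<open>DIM('a)\<close> unit vectors, each
      with coefficient below \<open>d\<close>, which adds up to \<open>e\<close>.\<close>
    define d where "d = e / DIM('a)"
    have d: "d > 0" using e by (simp add: d_def)
    have "\<forall>\<^sub>F n in sequentially. \<forall>i\<in>Basis. \<forall>x\<in>UNIV. dist (partial_deriv i (F n) x) (G i x) < d"
      using uniform_limitD[OF unif d] by (intro eventually_ball_finite) auto
    then show "\<forall>\<^sub>F n in sequentially. \<forall>x\<in>UNIV. \<forall>v. norm (grad (F n) x \<bullet> v - g' x v) \<le> e * norm v"
    proof eventually_elim
      case (elim n)
      have "norm (grad (F n) x \<bullet> v - g' x v) \<le> e * norm v" for x v
      proof -
        have "norm (grad (F n) x - (\<Sum>i\<in>Basis. G i x *\<^sub>R i))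
            = norm (\<Sum>i\<in>Basis. (partial_deriv i (F n) x - G i x) *\<^sub>R i)"
          by (simp add: grad_def sum_subtractf scaleR_left_diff_distrib)
        also have "\<dots> \<le> (\<Sum>i\<in>(Basis :: 'a set). d)"
          using elim by (intro sum_norm_le) (simp add: dist_real_def less_imp_le)
        finally have "norm (grad (F n) x - (\<Sum>i\<in>Basis. G i x *\<^sub>R i)) \<le> e"
          by (simp add: d_def)
        then show ?thesis
          unfolding g'_def inner_diff_left[symmetric] real_norm_def
          by (intro order_trans[OF Cauchy_Schwarz_ineq2] mult_right_mono) auto
      qed
      then show ?case by blast
    qed
  qed (use diff lim in \<open>auto intro: has_derivative_grad\<close>)
  then obtain g where g: "\<And>x. (\<lambda>n. F n x) \<longlonglongrightarrow> g x" "\<And>x. (g has_derivative g' x) (at x)"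
    by auto
  have "g = f"
    using LIMSEQ_unique[OF g(1) lim] by auto
  then have f: "(f has_derivative g' x) (at x)" for x
    using g(2) by simp
  then show "f differentiable at x"
    by (auto simp: differentiable_def)
  show "partial_deriv i f = G i" if "i \<in> Basis"
  proof
    fix x
    have "partial_deriv i f x = g' x i"
      using frechet_derivative_at[OF f] by (metis partial_deriv_def)
    also have "\<dots> = (\<Sum>j\<in>Basis. if j = i then G j x else 0)"
      unfolding g'_def inner_sum_left using that by (intro sum.cong) (auto simp: inner_Basis)
    also have "\<dots> = G i x"
      using that by (subst sum.delta) auto
    finally show "partial_deriv i f x = G i x" .
  qed
qed

lemma C2b_bounds:
  assumes "h \<in> C2b"
  shows "\<bar>h x\<bar> \<le> c2_norm h"
    and "i \<in> Basis \<Longrightarrow> \<bar>partial_deriv i h x\<bar> \<le> c2_norm h"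
    and "i \<in> Basis \<Longrightarrow> j \<in> Basis \<Longrightarrow> \<bar>partial_deriv j (partial_deriv i h) x\<bar> \<le> c2_norm h"
  using Max_c2_jet_le_c2_norm[OF assms, of x] by (auto simp: Max_c2_jet_le_iff)

lemma partial_deriv_diff:
  assumes "\<And>x. f differentiable at x" "\<And>x. g differentiable at x"
  shows "partial_deriv i (\<lambda>x. f x - g x) = (\<lambda>x. partial_deriv i f x - partial_deriv i g x)"
proof -
  have "partial_deriv i (\<lambda>x. f x + - 1 * g x) = (\<lambda>x. partial_deriv i f x + - 1 * partial_deriv i g x)"
    using assms partial_deriv_scale[of g i "- 1"]
    by (subst partial_deriv_add) (auto intro!: differentiable_minus)
  then show ?thesis by simp
qed

lemma C2_differentiable:
  assumes "h \<in> C2"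
  shows "h differentiable at x"
    and "i \<in> Basis \<Longrightarrow> partial_deriv i h differentiable at x"
    and "i \<in> Basis \<Longrightarrow> j \<in> Basis \<Longrightarrow> continuous_on UNIV (partial_deriv j (partial_deriv i h))"
  using assms by (auto simp: C2_def)

lemma C2_partial_diff:
  assumes "f \<in> C2" "g \<in> C2"
  shows "partial_deriv i (\<lambda>x. f x - g x) = (\<lambda>x. partial_deriv i f x - partial_deriv i g x)"
    and "i \<in> Basis \<Longrightarrow> partial_deriv j (\<lambda>x. partial_deriv i f x - partial_deriv i g x)
        = (\<lambda>x. partial_deriv j (partial_deriv i f) x - partial_deriv j (partial_deriv i g) x)"
  using assms by (simp_all add: partial_deriv_diff C2_differentiable)

text \<open>A Cauchy sequence in \<open>c2_norm\<close> is uniformly Cauchy together with its first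
  and second partial derivatives. Term-by-term differentiation identifies the three kinds of limits
  as derivatives of one function, and the second-order limits are continuous as uniform
  limits.\<close>

lemma C2b_complete:
  fixes F :: "nat \<Rightarrow> 'a::euclidean_space \<Rightarrow> real"
  assumes F: "\<And>n. F n \<in> C2b"
    and Cau: "\<And>e. e > 0 \<Longrightarrow> \<exists>N. \<forall>m\<ge>N. \<forall>n\<ge>N. c2_norm (\<lambda>x. F m x - F n x) < e"
  shows "\<exists>f\<in>C2b. (\<lambda>n. c2_norm (\<lambda>x. F n x - f x)) \<longlonglongrightarrow> 0"
proof -
  have F2: "F n \<in> C2" for n using F C2bD by blast
  note dif = C2_partial_diff[OF F2 F2]
  have b: "\<bar>F m x - F n x\<bar> \<le> c2_norm (\<lambda>x. F m x - F n x)"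
    "i \<in> Basis \<Longrightarrow> \<bar>partial_deriv i (F m) x - partial_deriv i (F n) x\<bar> \<le> c2_norm (\<lambda>x. F m x - F n x)"
    "i \<in> Basis \<Longrightarrow> j \<in> Basis \<Longrightarrow>
      \<bar>partial_deriv j (partial_deriv i (F m)) x - partial_deriv j (partial_deriv i (F n)) x\<bar>
        \<le> c2_norm (\<lambda>x. F m x - F n x)" for m n and i j x :: 'a
    using C2b_bounds[OF C2b_diff[OF F[of m] F[of n]]] by (simp_all add: dif)
  have lim: "\<exists>l. uniform_limit UNIV S l sequentially"
    if "\<And>m n x. \<bar>S m x - S n x\<bar> \<le> c2_norm (\<lambda>x. F m x - F n x)" for S :: "nat \<Rightarrow> 'a \<Rightarrow> real"
  proof -
    have "uniformly_Cauchy_on UNIV S"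
      unfolding uniformly_Cauchy_on_def dist_real_def using Cau that by (meson order.strict_trans1)
    then have "uniformly_convergent_on UNIV S"
      by (rule Cauchy_uniformly_convergent)
    then show ?thesis by (auto simp: uniformly_convergent_on_def)
  qed
  obtain f where f: "uniform_limit UNIV F f sequentially"
    using lim[of F, OF b(1)] by blast
  have "\<forall>i\<in>Basis. \<exists>l. uniform_limit UNIV (\<lambda>n. partial_deriv i (F n)) l sequentially"
    by (intro ballI lim b(2))
  then obtain G where G: "\<And>i. i \<in> Basis \<Longrightarrow> uniform_limit UNIV (\<lambda>n. partial_deriv i (F n)) (G i) sequentially"
    by metis
  have "\<forall>i\<in>Basis. \<forall>j\<in>Basis. \<exists>l. uniform_limit UNIV (\<lambda>n. partial_deriv j (partial_deriv i (F n))) l sequentially"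
    by (intro ballI lim b(3))
  then obtain H where H: "\<And>i j. i \<in> Basis \<Longrightarrow> j \<in> Basis \<Longrightarrow>
      uniform_limit UNIV (\<lambda>n. partial_deriv j (partial_deriv i (F n))) (H i j) sequentially"
    by metis
  have df: "f differentiable at x" "i \<in> Basis \<Longrightarrow> partial_deriv i f = G i" for x i
    using C2_differentiable[OF F2] G tendsto_uniform_limitI[OF f]
    by (auto intro: partial_deriv_uniform_limit[of F f G])
  have dG: "G i differentiable at x" "j \<in> Basis \<Longrightarrow> partial_deriv j (G i) = H i j"
    if "i \<in> Basis" for x i j
    using C2_differentiable[OF F2] H tendsto_uniform_limitI[OF G[OF that]] that
    by (auto intro: partial_deriv_uniform_limit[of "\<lambda>n. partial_deriv i (F n)" "G i" "H i"])
  have cH: "continuous_on UNIV (H i j)" if "i \<in> Basis" "j \<in> Basis" for i j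
    using that C2_differentiable[OF F2] by (intro uniform_limit_theorem[OF _ H]) auto
  have f2: "f \<in> C2"
    using df dG cH by (auto simp: C2_def)
  \<comment> \<open>Let \<open>m\<close> tend to infinity in the Cauchy estimate. The pointwise form
    \<open>bd\<close> is kept beside \<open>le\<close> because a bound on the supremum
    \<open>c2_norm\<close> carries no information until the difference is known to lie in
    \<open>C2b\<close>.\<close>
  have le: "c2_norm (\<lambda>x. F n x - f x) \<le> e" and bd: "Max (c2_jet (\<lambda>x. F n x - f x) x) \<le> e"
    if e: "\<forall>m\<ge>N. c2_norm (\<lambda>x. F n x - F m x) < e" for n e N x
  proof -
    have L: "\<bar>S n x - l x\<bar> \<le> e"
      if "uniform_limit UNIV S l sequentially" "\<And>m n x. \<bar>S m x - S n x\<bar> \<le> c2_norm (\<lambda>x. F m x - F n x)"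
      for S :: "nat \<Rightarrow> 'a \<Rightarrow> real" and l x
    proof (rule Lim_bounded)
      show "(\<lambda>m. \<bar>S n x - S m x\<bar>) \<longlonglongrightarrow> \<bar>S n x - l x\<bar>"
        by (intro tendsto_intros tendsto_uniform_limitI[OF that(1)]) auto
      show "\<forall>m\<ge>N. \<bar>S n x - S m x\<bar> \<le> e"
        using e that(2)[of n x] by (meson less_imp_le order_trans)
    qed
    have "\<bar>partial_deriv i (F n) x - G i x\<bar> \<le> e" if "i \<in> Basis" for i x
      using L[where S = "\<lambda>n. partial_deriv i (F n)", OF G b(2)] that by blast
    moreover have "\<bar>partial_deriv j (partial_deriv i (F n)) x - H i j x\<bar> \<le> e"
      if "i \<in> Basis" "j \<in> Basis" for i j x
      using L[where S = "\<lambda>n. partial_deriv j (partial_deriv i (F n))", OF H b(3)] that by blast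
    ultimately show *: "Max (c2_jet (\<lambda>x. F n x - f x) x) \<le> e" for x
      unfolding Max_c2_jet_le_iff using L[where S = F, OF f b(1)]
      by (simp add: C2_partial_diff[OF F2 f2] df dG partial_deriv_diff C2_differentiable[OF F2])
    show "c2_norm (\<lambda>x. F n x - f x) \<le> e"
      by (rule c2_norm_le) (rule *)
  qed
  obtain N where "\<forall>m\<ge>N. c2_norm (\<lambda>x. F N x - F m x) < 1"
    using Cau[of 1] by auto
  moreover have "(\<lambda>x. F N x - f x) \<in> C2"
    using C2_add[OF F2 C2_scale[OF f2], of N "- 1"] by simp
  ultimately have "(\<lambda>x. F N x - f x) \<in> C2b"
    using bd by (intro C2bI[where c = 1]) auto
  then have "f \<in> C2b"
    using C2b_diff[OF F[of N]] by fastforce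
  moreover have "(\<lambda>n. c2_norm (\<lambda>x. F n x - f x)) \<longlonglongrightarrow> 0"
  proof (rule LIMSEQ_I)
    fix r :: real assume "r > 0"
    then obtain N where N: "\<forall>m\<ge>N. \<forall>n\<ge>N. c2_norm (\<lambda>x. F m x - F n x) < r / 2"
      using Cau[of "r / 2"] by auto
    have "norm (c2_norm (\<lambda>x. F n x - f x) - 0) < r" if "n \<ge> N" for n
    proof -
      have "0 \<le> c2_norm (\<lambda>x. F n x - f x)"
        using C2b_bounds(1)[OF C2b_diff[OF F \<open>f \<in> C2b\<close>], of n undefined] by linarith
      moreover have "c2_norm (\<lambda>x. F n x - f x) \<le> r / 2"
        using le[of N n "r / 2"] N that by blast
      ultimately show ?thesis using \<open>r > 0\<close> by simp
    qed
    then show "\<exists>no. \<forall>n\<ge>no. norm (c2_norm (\<lambda>x. F n x - f x) - 0) < r" by blast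
  qed
  ultimately show ?thesis by blast
qed

instance c2b :: (euclidean_space) banach
proof
  fix F :: "nat \<Rightarrow> 'a c2b"
  assume "Cauchy F"
  have d: "dist f g = c2_norm (\<lambda>x. apply_c2b f x - apply_c2b g x)" for f g :: "'a c2b"
    by (simp add: dist_c2b_def norm_c2b.rep_eq minus_c2b.rep_eq)
  have "\<exists>f\<in>C2b. (\<lambda>n. c2_norm (\<lambda>x. apply_c2b (F n) x - f x)) \<longlonglongrightarrow> 0"
    using \<open>Cauchy F\<close> by (intro C2b_complete apply_c2b) (auto simp: Cauchy_def d)
  then obtain f where "f \<in> C2b" "(\<lambda>n. c2_norm (\<lambda>x. apply_c2b (F n) x - f x)) \<longlonglongrightarrow> 0" by blast
  then have "(\<lambda>n. dist (F n) (Abs_c2b f)) \<longlonglongrightarrow> 0"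
    by (simp add: d Abs_c2b_inverse)
  then show "convergent F"
    unfolding convergent_def tendsto_dist_iff[of F] by blast
qed

text \<open>By pointwise boundedness the closed sets \<open>C n\<close> cover the complete space, so
  by Baire one of them contains a ball. On that ball all functionals share a bound, and differences
  of points of the ball reach every direction.\<close>

lemma uniform_boundedness:
  fixes G :: "('a::banach \<Rightarrow>\<^sub>L 'b::real_normed_vector) set"
  assumes "\<And>x. \<exists>B. \<forall>g\<in>G. norm (blinfun_apply g x) \<le> B"
  shows "\<exists>B. \<forall>g\<in>G. norm g \<le> B"
proof -
  define C where "C n = {x. \<forall>g\<in>G. norm (blinfun_apply g x) \<le> real n}" for n
  have C_eq: "C n = (\<Inter>g\<in>G. {x. norm (blinfun_apply g x) \<le> real n})" for n
    by (auto simp: C_def)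
  have closed: "closed (C n)" for n
    unfolding C_eq by (intro closed_INT ballI closed_Collect_le continuous_intros)
  have "\<exists>n. x \<in> C n" for x
  proof -
    obtain B where B: "\<forall>g\<in>G. norm (blinfun_apply g x) \<le> B"
      using assms by blast
    obtain n where "B \<le> real n" using real_arch_simple by blast
    with B have "x \<in> C n" by (fastforce simp: C_def)
    then show ?thesis ..
  qed
  then have UN: "\<Union>(range C) = UNIV" by blast
  have "\<exists>n. interior (C n) \<noteq> {}"
  proof (rule ccontr)
    \<comment> \<open>Baire: a countable union of closed sets without interior has no interior, but
      this union is the whole space.\<close>
    assume "\<not> ?thesis"
    then have "Met_TC.mtopology interior_of \<Union>(range C) = {}"
      using closed complete_UNIV
      by (intro Met_TC.metric_Baire_category_alt) auto
    then show False by (simp add: UN)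
  qed
  then obtain n x where "x \<in> interior (C n)" by blast
  then obtain e where e: "e > 0" "cball x e \<subseteq> C n"
    by (meson mem_interior_cball)
  have "norm g \<le> 2 * real n / e" if "g \<in> G" for g
  proof (rule norm_blinfun_bound)
    fix v
    show "norm (blinfun_apply g v) \<le> 2 * real n / e * norm v"
    proof (cases "v = 0")
      case False
      \<comment> \<open>\<open>w\<close> is \<open>v\<close> rescaled to norm \<open>e\<close>, so
        that \<open>x + w\<close> is still in the ball; \<open>g w\<close> is then a difference of
        two values bounded by \<open>n\<close>.\<close>
      define w where "w = (e / norm v) *\<^sub>R v"
      have "x + w \<in> C n" "x \<in> C n"
        using e False by (auto simp: w_def dist_norm)
      then have "norm (blinfun_apply g (x + w)) + norm (blinfun_apply g x) \<le> 2 * real n"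
        using that by (fastforce simp: C_def)
      moreover have "norm (blinfun_apply g w) \<le> norm (blinfun_apply g (x + w)) + norm (blinfun_apply g x)"
        using norm_triangle_ineq4[of "blinfun_apply g (x + w)" "blinfun_apply g x"]
        by (simp add: blinfun.add_right)
      ultimately have "norm (blinfun_apply g w) \<le> 2 * real n" by linarith
      then show ?thesis
        using e False by (simp add: w_def blinfun.scaleR_right field_simps)
    qed simp
  qed (use e in simp)
  then show ?thesis by blast
qed

subsection \<open>Support of the stationary distribution\<close>

lemma wasserstein2_less_couplingE:
  assumes "wasserstein2 \<mu> \<nu> < ennreal r"
  obtains \<gamma> where "\<gamma> \<in> couplings \<mu> \<nu>" "(\<integral>\<^sup>+ (x, y). ennreal ((dist x y)\<^sup>2) \<partial>\<gamma>) < ennreal (r\<^sup>2)"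
proof -
  define I where "I = (INF \<gamma>\<in>couplings \<mu> \<nu>. \<integral>\<^sup>+ (x, y). ennreal ((dist x y)\<^sup>2) \<partial>\<gamma>)"
  have W: "ennreal_sqrt I < ennreal r"
    using assms by (simp add: wasserstein2_def I_def)
  then have fin: "I \<noteq> \<infinity>"
    by (auto simp: ennreal_sqrt_def)
  then have "sqrt (enn2real I) < r"
    using W by (simp add: ennreal_sqrt_def ennreal_less_iff)
  then have "(sqrt (enn2real I))\<^sup>2 < r\<^sup>2"
    by (intro power_strict_mono) auto
  then have "enn2real I < r\<^sup>2" by simp
  then have "I < ennreal (r\<^sup>2)"
    using fin by (cases I) (auto simp: ennreal_less_iff)
  then show thesis
    using that by (auto simp: I_def INF_less_iff)
qed

text \<open>The easy half of Kantorovich duality: under a coupling, the two integrals differ by at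
  most \<open>K\<close> times the mean distance, which the root mean square distance dominates.
  Boundedness of \<open>\<phi>\<close> makes the integrals exist without moment conditions.\<close>

lemma wasserstein2_lipschitz:
  fixes \<phi> :: "'a::euclidean_space \<Rightarrow> real"
  assumes \<mu>: "prob_space \<mu>" and \<nu>: "prob_space \<nu>"
    and W: "wasserstein2 \<mu> \<nu> \<le> ennreal r" and "0 \<le> r" "0 \<le> K"
    and Lip: "\<And>x y. \<bar>\<phi> x - \<phi> y\<bar> \<le> K * dist x y"
    and B: "\<And>x. \<bar>\<phi> x\<bar> \<le> B"
  shows "\<bar>(\<integral>x. \<phi> x \<partial>\<mu>) - (\<integral>x. \<phi> x \<partial>\<nu>)\<bar> \<le> K * r"
proof -
  \<comment> \<open>Attainment of the infimum over couplings is not at hand, so the bound is shown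
    for every \<open>R > r\<close>, where some coupling has cost below \<open>R\<^sup>2\<close>;
    then \<open>R\<close> decreases to \<open>r\<close>.\<close>
  have bound: "\<bar>(\<integral>x. \<phi> x \<partial>\<mu>) - (\<integral>x. \<phi> x \<partial>\<nu>)\<bar> \<le> K * R" if "r < R" for R
  proof -
    have R: "R > 0" using that \<open>0 \<le> r\<close> by simp
    have "wasserstein2 \<mu> \<nu> < ennreal R"
      using W that \<open>0 \<le> r\<close> by (simp add: order.strict_trans1 ennreal_less_iff)
    then obtain \<gamma> where \<gamma>: "\<gamma> \<in> couplings \<mu> \<nu>"
      and cost: "(\<integral>\<^sup>+ (x, y). ennreal ((dist x y)\<^sup>2) \<partial>\<gamma>) < ennreal (R\<^sup>2)"
      by (rule wasserstein2_less_couplingE)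
    have [measurable_cong]: "sets \<gamma> = sets (borel \<Otimes>\<^sub>M borel)"
      and fst: "distr \<gamma> borel fst = \<mu>" and snd: "distr \<gamma> borel snd = \<nu>"
      using \<gamma> by (simp_all only: couplings_def borel_prod mem_Collect_eq)
    interpret prob_space \<gamma>
      by (rule prob_space_distrD[where f = fst and N = borel]) (measurable, simp only: fst \<mu>)
    have "K-lipschitz_on UNIV \<phi>"
      using Lip \<open>0 \<le> K\<close> by (intro lipschitz_onI) (auto simp: dist_real_def)
    then have [measurable]: "\<phi> \<in> borel_measurable borel"
      by (intro borel_measurable_continuous_onI lipschitz_on_continuous_on)
    have sq: "integrable \<gamma> (\<lambda>p. (dist (fst p) (snd p))\<^sup>2)"
      using cost by (intro integrableI_nonneg) (auto simp: case_prod_beta' order.strict_trans)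
    have sq_le: "(\<integral>p. (dist (fst p) (snd p))\<^sup>2 \<partial>\<gamma>) \<le> R\<^sup>2"
      using enn2real_leI[OF _ less_imp_le[OF cost]] by (subst integral_eq_nn_integral)
        (auto simp: case_prod_beta')
    have int: "integrable \<gamma> (\<lambda>p. \<phi> (fst p))" "integrable \<gamma> (\<lambda>p. \<phi> (snd p))"
      by (rule integrable_const_bound[where B = B]; use B in auto)+
    have "(\<integral>x. \<phi> x \<partial>\<mu>) - (\<integral>x. \<phi> x \<partial>\<nu>) = (\<integral>p. \<phi> (fst p) - \<phi> (snd p) \<partial>\<gamma>)"
      unfolding fst[symmetric] snd[symmetric] using int by (simp add: integral_distr)
    also have "\<bar>\<dots>\<bar> \<le> (\<integral>p. \<bar>\<phi> (fst p) - \<phi> (snd p)\<bar> \<partial>\<gamma>)"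
      by (rule integral_abs_bound)
    also have "\<dots> \<le> (\<integral>p. K * ((dist (fst p) (snd p))\<^sup>2 / (2 * R) + R / 2) \<partial>\<gamma>)"
    proof (rule integral_mono)
      fix p :: "'a \<times> 'a"
      \<comment> \<open>AM-GM\<close>
      have "dist (fst p) (snd p) \<le> (dist (fst p) (snd p))\<^sup>2 / (2 * R) + R / 2"
        using R sum_squares_bound[of "dist (fst p) (snd p)" R]
        by (simp add: field_simps power2_eq_square)
      then show "\<bar>\<phi> (fst p) - \<phi> (snd p)\<bar> \<le> K * ((dist (fst p) (snd p))\<^sup>2 / (2 * R) + R / 2)"
        using Lip[of "fst p" "snd p"] \<open>0 \<le> K\<close> by (meson mult_left_mono order_trans)
    qed (use int sq in auto)
    also have "\<dots> = K * ((\<integral>p. (dist (fst p) (snd p))\<^sup>2 \<partial>\<gamma>) / (2 * R) + R / 2)"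
      using sq by (simp add: prob_space)
    also have "\<dots> \<le> K * (R\<^sup>2 / (2 * R) + R / 2)"
      using sq_le R \<open>0 \<le> K\<close> by (intro mult_left_mono add_right_mono divide_right_mono) auto
    also have "\<dots> = K * R"
      using R by (simp add: power2_eq_square)
    finally show ?thesis .
  qed
  have "((\<lambda>R. K * R) \<longlongrightarrow> K * r) (at_right r)"
    by (intro tendsto_intros)
  then show ?thesis
    by (rule tendsto_lowerbound) (auto intro!: eventually_mono[OF eventually_at_right_less bound])
qed

lemma markov_chain_distr_Suc:
  assumes "prob_space M" "markov_chain M N S P"
  shows "distr M N (S (Suc k)) = distr M N (S k) \<bind> P"
proof -
  interpret prob_space M by fact
  have S[measurable]: "\<And>k. S k \<in> M \<rightarrow>\<^sub>M N" and P[measurable]: "P \<in> N \<rightarrow>\<^sub>M prob_algebra N"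
    and step: "\<And>B. B \<in> sets N \<Longrightarrow> AE \<omega> in M.
        real_cond_exp M (history_algebra M N S k) (\<lambda>\<omega>. indicator B (S (Suc k) \<omega>)) \<omega>
          = measure (P (S k \<omega>)) B"
    using assms(2) by (auto simp: markov_chain_def)
  have "sets (history_algebra M N S k) \<subseteq> sets M"
    unfolding history_algebra_def by (rule sets_image_in_sets) auto
  then interpret sub: finite_measure_subalgebra M "history_algebra M N S k"
    by unfold_locales (auto simp: subalgebra_def history_algebra_def)
  have ne: "space (distr M N (S k)) \<noteq> {}"
    using not_empty measurable_space[OF S] by auto
  show ?thesis
  proof (rule measure_eqI)
    show "sets (distr M N (S (Suc k))) = sets (distr M N (S k) \<bind> P)"
      using measurable_space[OF P] by (subst sets_bind[OF _ ne, where N = N]) (auto simp: space_prob_algebra)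
    fix B assume "B \<in> sets (distr M N (S (Suc k)))"
    then have B[measurable]: "B \<in> sets N" by simp
    have ind: "integrable M (\<lambda>\<omega>. indicator B (S (Suc k) \<omega>) :: real)"
      by (rule integrable_const_bound[where B = 1]) (auto simp: indicator_def)
    have "emeasure (distr M N (S (Suc k))) B = (\<integral>\<^sup>+\<omega>. indicator B (S (Suc k) \<omega>) \<partial>M)"
      using nn_integral_distr[OF S, of "indicator B" "Suc k"] by simp
    also have "\<dots> = ennreal (\<integral>\<omega>. indicator B (S (Suc k) \<omega>) \<partial>M)"
      using ind by (subst nn_integral_eq_integral[symmetric]) (auto simp: ennreal_indicator)
    \<comment> \<open>Integrating the conditional probability given by the Markov property removes
      the conditioning on the history.\<close>
    also have "(\<integral>\<omega>. indicator B (S (Suc k) \<omega>) \<partial>M) = (\<integral>\<omega>. measure (P (S k \<omega>)) B \<partial>M)"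
      unfolding sub.real_cond_exp_int(2)[OF ind, symmetric]
      by (intro integral_cong_AE step) auto
    also have "ennreal \<dots> = (\<integral>\<^sup>+\<omega>. emeasure (P (S k \<omega>)) B \<partial>M)"
    proof -
      have p: "prob_space (P (S k \<omega>))" if "\<omega> \<in> space M" for \<omega>
        using measurable_space[OF P, of "S k \<omega>"] measurable_space[OF S that]
        by (simp add: space_prob_algebra)
      have "integrable M (\<lambda>\<omega>. measure (P (S k \<omega>)) B)"
        by (rule integrable_const_bound[where B = 1]) (auto simp: p prob_space.prob_le_1)
      then have "ennreal (\<integral>\<omega>. measure (P (S k \<omega>)) B \<partial>M) = (\<integral>\<^sup>+\<omega>. ennreal (measure (P (S k \<omega>)) B) \<partial>M)"
        by (subst nn_integral_eq_integral) auto
      also have "\<dots> = (\<integral>\<^sup>+\<omega>. emeasure (P (S k \<omega>)) B \<partial>M)"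
        by (intro nn_integral_cong)
          (simp add: p finite_measure.emeasure_eq_measure prob_space.finite_measure)
      finally show ?thesis .
    qed
    also have "\<dots> = emeasure (distr M N (S k) \<bind> P) B"
      using ne measurable_compose[OF measurable_prob_algebraD[OF P] measurable_emeasure_subprob_algebra[OF B]]
      by (subst emeasure_bind[where N = N]) (auto simp: nn_integral_distr measurable_prob_algebraD)
    finally show "emeasure (distr M N (S (Suc k))) B = emeasure (distr M N (S k) \<bind> P) B" .
  qed
qed

section \<open>Where the stationary laws live\<close>

lemma integral_bind_prob:
  fixes \<phi> :: "'b \<Rightarrow> real"
  assumes "prob_space \<mu>" "P \<in> \<mu> \<rightarrow>\<^sub>M prob_algebra N" "\<phi> \<in> borel_measurable N" "\<And>x. \<bar>\<phi> x\<bar> \<le> B"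
  shows "(\<integral>x. \<phi> x \<partial>(\<mu> \<bind> P)) = (\<integral>p. (\<integral>x. \<phi> x \<partial>P p) \<partial>\<mu>)"
proof (rule integral_bind[where K = N and B = B and B' = 1])
  show "AE x in \<mu>. emeasure (P x) (space (P x)) \<le> ennreal 1"
    using measurable_space[OF assms(2)]
    by (auto simp: space_prob_algebra prob_space.emeasure_space_1)
qed (use assms in \<open>auto simp: measurable_prob_algebraD prob_space.finite_measure\<close>)

text \<open>For a test function \<open>\<phi>\<close> vanishing on the ball, the iterates \<open>P\<^sup>n \<phi>\<close> vanish at a typical starting
  point of the chain and are \<open>L\<^sup>n\<close>-Lipschitz, so they tend to \<open>0\<close> everywhere; their integrals against
  a stationary distribution do not depend on \<open>n\<close>.\<close>

lemma AE_stationary_norm_le: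
  fixes P :: "'a::euclidean_space \<Rightarrow> 'a measure"
  assumes M: "prob_space M" and chain: "markov_chain M borel S P"
    and bd: "\<And>k. AE \<omega> in M. norm (S k \<omega>) \<le> C"
    and L: "0 \<le> L" "L < 1"
    and contr: "\<And>p q. wasserstein2 (P p) (P q) \<le> ennreal (L * dist p q)"
    and stat: "stationary_distribution borel P \<pi>"
  shows "AE p in \<pi>. norm p \<le> C"
proof -
  interpret prob_space M by fact
  have S[measurable]: "\<And>k. S k \<in> M \<rightarrow>\<^sub>M borel" and P[measurable]: "P \<in> borel \<rightarrow>\<^sub>M prob_algebra borel"
    using chain by (auto simp: markov_chain_def)
  have P_prob: "prob_space (P p)" and [measurable_cong]: "sets (P p) = sets borel" for p
    using measurable_space[OF P, of p] by (auto simp: space_prob_algebra)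
  have \<pi>: "prob_space \<pi>" and [measurable_cong]: "sets \<pi> = sets borel" and \<pi>P: "\<pi> \<bind> P = \<pi>"
    using stat by (auto simp: stationary_distribution_def space_prob_algebra)
  \<comment> \<open>\<open>\<psi> 0\<close> is the excess of the norm over \<open>C\<close>,
    truncated at 1: bounded, 1-Lipschitz, and zero exactly where \<open>norm p \<le> C\<close>.
    \<open>\<psi> n\<close> is its image under \<open>n\<close> applications of the kernel.\<close>
  define \<psi> where "\<psi> n = ((\<lambda>\<phi> p. \<integral>x. \<phi> x \<partial>P p) ^^ n) (\<lambda>p. min 1 (max 0 (norm p - C)))" for n
  have \<psi>_0: "\<psi> 0 = (\<lambda>p. min 1 (max 0 (norm p - C)))"
    and \<psi>_Suc: "\<psi> (Suc n) = (\<lambda>p. \<integral>x. \<psi> n x \<partial>P p)" for n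
    by (simp_all add: \<psi>_def)
  have \<psi>: "(\<forall>p. 0 \<le> \<psi> n p \<and> \<psi> n p \<le> 1) \<and> (\<forall>p q. \<bar>\<psi> n p - \<psi> n q\<bar> \<le> L ^ n * dist p q)" for n
  proof (induction n)
    case 0
    have "\<bar>\<psi> 0 p - \<psi> 0 q\<bar> \<le> dist p q" for p q
      using norm_triangle_ineq3[of p q] unfolding \<psi>_0 dist_norm by linarith
    then show ?case by (auto simp: \<psi>_0)
  next
    case (Suc n)
    have le: "\<bar>\<psi> (Suc n) p - \<psi> (Suc n) q\<bar> \<le> L ^ Suc n * dist p q" for p q
      unfolding \<psi>_Suc using Suc L
        wasserstein2_lipschitz[OF P_prob P_prob contr, of p q "L ^ n" "\<psi> n" 1]
      by (simp add: mult_ac)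
    have "0 \<le> \<psi> (Suc n) p \<and> \<psi> (Suc n) p \<le> 1" for p
    proof -
      interpret Pp: prob_space "P p" by (rule P_prob)
      have "(L ^ n)-lipschitz_on UNIV (\<psi> n)"
        using Suc L by (intro lipschitz_onI) (auto simp: dist_real_def)
      then have [measurable]: "\<psi> n \<in> borel_measurable borel"
        by (intro borel_measurable_continuous_onI lipschitz_on_continuous_on)
      have "integrable (P p) (\<psi> n)"
        by (rule Pp.integrable_const_bound[where B = 1]) (use Suc in auto)
      then show ?thesis
        unfolding \<psi>_Suc using Suc by (auto intro!: integral_nonneg_AE Pp.integral_le_const)
    qed
    with le show ?case by blast
  qed
  have [measurable]: "\<psi> n \<in> borel_measurable borel" for n
  proof -
    have "(L ^ n)-lipschitz_on UNIV (\<psi> n)"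
      using \<psi> L by (intro lipschitz_onI) (auto simp: dist_real_def)
    then show ?thesis
      by (intro borel_measurable_continuous_onI lipschitz_on_continuous_on)
  qed
  \<comment> \<open>One application of the kernel is traded for one time step, so the mean of
    \<open>\<psi> n (S k)\<close> is that of \<open>\<psi> 0 (S (k + n))\<close>, which vanishes by
    \<open>bd\<close>.\<close>
  have shift: "(\<integral>\<omega>. \<psi> n (S (Suc k) \<omega>) \<partial>M) = (\<integral>\<omega>. \<psi> (Suc n) (S k \<omega>) \<partial>M)" for n k
  proof -
    have "(\<integral>\<omega>. \<psi> n (S (Suc k) \<omega>) \<partial>M) = (\<integral>p. \<psi> n p \<partial>distr M borel (S (Suc k)))"
      by (simp add: integral_distr)
    also have "\<dots> = (\<integral>p. \<psi> (Suc n) p \<partial>distr M borel (S k))"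
      unfolding markov_chain_distr_Suc[OF M chain] \<psi>_Suc
      by (rule integral_bind_prob[where N = borel and B = 1]) (use \<psi> in \<open>auto intro!: prob_space_distr\<close>)
    also have "\<dots> = (\<integral>\<omega>. \<psi> (Suc n) (S k \<omega>) \<partial>M)"
      by (simp add: integral_distr)
    finally show ?thesis .
  qed
  have "(\<integral>\<omega>. \<psi> n (S k \<omega>) \<partial>M) = 0" for n k
  proof (induction n arbitrary: k)
    case 0
    have "(\<integral>\<omega>. \<psi> 0 (S k \<omega>) \<partial>M) = (\<integral>\<omega>. 0 \<partial>M)"
      using bd[of k] by (intro integral_cong_AE) (auto simp: \<psi>_0)
    then show ?case by simp
  qed (simp add: shift[symmetric])
  then have "AE \<omega> in M. \<psi> n (S 0 \<omega>) = 0" for n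
    using \<psi> by (subst integral_nonneg_eq_0_iff_AE[symmetric])
      (auto intro!: integrable_const_bound[where B = 1])
  then have "AE \<omega> in M. \<forall>n. \<psi> n (S 0 \<omega>) = 0"
    by (simp add: AE_all_countable)
  \<comment> \<open>An almost sure event of a probability space is nonempty. This yields a single
    starting point \<open>q\<close> at which all iterates vanish, from which the Lipschitz constants
    \<open>L ^ n\<close> control every other point.\<close>
  have "\<exists>\<omega>. \<forall>n. \<psi> n (S 0 \<omega>) = 0"
  proof (rule ccontr)
    assume "\<nexists>\<omega>. \<forall>n. \<psi> n (S 0 \<omega>) = 0"
    then have "AE \<omega> in M. False"
      by (intro eventually_mono[OF \<open>AE \<omega> in M. \<forall>n. \<psi> n (S 0 \<omega>) = 0\<close>]) blast
    then show False by simp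
  qed
  then obtain q where q: "\<And>n. \<psi> n q = 0" by blast
  have lim: "(\<lambda>n. \<psi> n p) \<longlonglongrightarrow> 0" for p
  proof (rule Lim_null_comparison)
    show "(\<lambda>n. L ^ n * dist p q) \<longlonglongrightarrow> 0"
      using L by (intro tendsto_mult_left_zero LIMSEQ_power_zero) auto
    have "norm (\<psi> n p) \<le> L ^ n * dist p q" for n
      using \<psi>[of n] q[of n] by (metis diff_zero real_norm_def)
    then show "\<forall>\<^sub>F n in sequentially. norm (\<psi> n p) \<le> L ^ n * dist p q" by simp
  qed
  have "(\<lambda>n. \<integral>p. \<psi> n p \<partial>\<pi>) \<longlonglongrightarrow> (\<integral>p. 0 \<partial>\<pi>)"
    using \<psi> lim prob_space.finite_measure[OF \<pi>]
    by (intro integral_dominated_convergence[where w = "\<lambda>_. 1"])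
      (auto intro!: finite_measure.integrable_const)
  moreover have "(\<integral>p. \<psi> n p \<partial>\<pi>) = (\<integral>p. \<psi> 0 p \<partial>\<pi>)" for n
  proof (induction n)
    case (Suc n)
    have "(\<integral>p. \<psi> n p \<partial>(\<pi> \<bind> P)) = (\<integral>p. \<psi> (Suc n) p \<partial>\<pi>)"
      unfolding \<psi>_Suc using \<pi> \<psi> by (intro integral_bind_prob[where N = borel and B = 1]) auto
    with Suc show ?case by (simp add: \<pi>P)
  qed simp
  ultimately have "(\<integral>p. \<psi> 0 p \<partial>\<pi>) = 0"
    by (metis (no_types, lifting) LIMSEQ_unique integral_zero LIMSEQ_const_iff ext)
  then have "AE p in \<pi>. \<psi> 0 p = 0"
    using \<psi> prob_space.finite_measure[OF \<pi>] by (subst integral_nonneg_eq_0_iff_AE[symmetric])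
      (auto intro!: finite_measure.integrable_const_bound[where B = 1])
  then show ?thesis
    by eventually_elim (auto simp: \<psi>_0 min_def max_def split: if_splits)
qed

text \<open>The \<open>(x, z)\<close> part of a transition depends only on the old
  \<open>(x, z)\<close> and is governed by \<open>P\<close>, so projecting the invariance equation
  gives invariance under \<open>P\<close>. The new output is a value of \<open>f\<close> whatever
  the old state was; hence one step enforces the bound on \<open>y\<close>, and a stationary law
  equals its own image under one step.\<close>

lemma
  fixes P :: "'a::euclidean_space \<times> 'b::euclidean_space \<Rightarrow> ('a \<times> 'b) measure"
    and f :: "'a \<times> 'b \<times> 'c::euclidean_space \<Rightarrow> real"
  assumes P: "P \<in> borel \<rightarrow>\<^sub>M prob_algebra borel" and \<nu>: "prob_space \<nu>" "sets \<nu> = sets borel"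
    and f: "f \<in> borel_measurable borel"
    and H: "memory_kernel P \<nu> f \<mu>b \<sigma> lam \<in> borel \<rightarrow>\<^sub>M prob_algebra borel"
    and stat: "stationary_distribution borel (memory_kernel P \<nu> f \<mu>b \<sigma> lam) \<mu>"
  shows stationary_memory_kernel_marginal:
      "stationary_distribution borel P (distr \<mu> borel (\<lambda>(x, z, y, u). (x, z)))" (is "stationary_distribution _ _ ?\<pi>")
    and AE_stationary_memory_kernel_output:
      "(\<And>v. \<bar>f v\<bar> \<le> B) \<Longrightarrow> AE (x, z, y, u) in \<mu>. \<bar>y\<bar> \<le> B"
proof -
  let ?H = "memory_kernel P \<nu> f \<mu>b \<sigma> lam" and ?pr = "\<lambda>(x, z, y, u). (x, z)"
  interpret \<nu>: prob_space \<nu> by fact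
  have \<mu>: "prob_space \<mu>" and sets_\<mu>[measurable_cong]: "sets \<mu> = sets borel" and \<mu>H: "\<mu> \<bind> ?H = \<mu>"
    using stat by (auto simp: stationary_distribution_def space_prob_algebra)
  have H'[measurable]: "?H \<in> \<mu> \<rightarrow>\<^sub>M subprob_algebra borel"
    using measurable_prob_algebraD[OF H] by (simp add: measurable_cong_sets[OF sets_\<mu> refl])
  have pr[measurable]: "(?pr :: 'a \<times> 'b \<times> real \<times> real \<Rightarrow> _) \<in> borel \<rightarrow>\<^sub>M borel"
    by (intro borel_measurable_continuous_onI) (auto simp: case_prod_unfold intro!: continuous_intros)
  have P_prob: "prob_space (P p)" and P_sets[measurable_cong]: "sets (P p) = sets borel" for p
    using measurable_space[OF P, of p] by (auto simp: space_prob_algebra)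
  have sets_pair: "sets (P p \<Otimes>\<^sub>M \<nu>) = sets borel" for p
    by (subst borel_prod[symmetric]) (rule sets_pair_measure_cong[OF P_sets \<nu>(2)])
  have next_meas: "(\<lambda>((x', z'), e). (x', z', f (x', z', e), v)) \<in> P p \<Otimes>\<^sub>M \<nu> \<rightarrow>\<^sub>M borel" for p and v :: real
  proof -
    have "(\<lambda>q. f (fst (fst q), snd (fst q), snd q)) \<in> borel_measurable borel"
      by (rule measurable_compose[OF _ f])
        (intro borel_measurable_continuous_onI continuous_intros)
    moreover have "(\<lambda>q :: ('a \<times> 'b) \<times> 'c. fst (fst q)) \<in> borel_measurable borel"
        "(\<lambda>q :: ('a \<times> 'b) \<times> 'c. snd (fst q)) \<in> borel_measurable borel"
      by (intro borel_measurable_continuous_onI continuous_intros)+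
    ultimately have "(\<lambda>q. (fst (fst q), snd (fst q), f (fst (fst q), snd (fst q), snd q), v)) \<in> borel_measurable borel"
      by (intro borel_measurable_Pair borel_measurable_const)
    then show ?thesis
      by (simp add: measurable_cong_sets[OF sets_pair refl] case_prod_unfold)
  qed
  have H_eq: "?H (x, z, y, u) = distr (P (x, z) \<Otimes>\<^sub>M \<nu>) borel
      (\<lambda>((x', z'), e). (x', z', f (x', z', e), memory_update \<mu>b \<sigma> lam x u))" for x z y u
    by (simp add: memory_kernel_def)
  have H_marginal: "distr (?H q) borel ?pr = P (?pr q)" for q
  proof -
    obtain x z y u where q: "q = (x, z, y, u)" by (metis surj_pair)
    have "distr (?H q) borel ?pr = distr (P (x, z) \<Otimes>\<^sub>M \<nu>) borel fst"
      unfolding q H_eq by (subst distr_distr[OF pr next_meas]) (simp add: comp_def case_prod_unfold)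
    also have "\<dots> = distr (P (x, z) \<Otimes>\<^sub>M \<nu>) (P (x, z)) fst"
      by (rule distr_cong) (simp_all add: P_sets)
    also have "\<dots> = P (x, z)"
      by (rule \<nu>.distr_pair_fst)
    finally show ?thesis by (simp add: q)
  qed
  have ne: "space \<mu> \<noteq> {}" by (rule prob_space.not_empty[OF \<mu>])
  have pr_\<mu>: "?pr \<in> \<mu> \<rightarrow>\<^sub>M borel" by measurable
  have "?\<pi> = distr (\<mu> \<bind> ?H) borel ?pr" by (simp add: \<mu>H)
  also have "\<dots> = \<mu> \<bind> (\<lambda>q. distr (?H q) borel ?pr)"
    by (rule distr_bind[OF H' ne pr])
  also have "\<dots> = ?\<pi> \<bind> P"
    unfolding H_marginal using ne
    by (subst bind_distr[OF pr_\<mu> measurable_prob_algebraD[OF P]]) auto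
  finally show "stationary_distribution borel P ?\<pi>"
    using \<mu> prob_space.prob_space_distr[OF \<mu> pr_\<mu>]
    by (simp add: stationary_distribution_def space_prob_algebra)
  assume B: "\<And>v. \<bar>f v\<bar> \<le> B"
  have [measurable]: "(\<lambda>(x, z, y, u). y) \<in> borel_measurable (borel :: ('a \<times> 'b \<times> real \<times> real) measure)"
    by (intro borel_measurable_continuous_onI) (auto simp: case_prod_unfold intro!: continuous_intros)
  have meas: "Measurable.pred borel (\<lambda>(x :: 'a, z :: 'b, y, u :: real). \<bar>y\<bar> \<le> B)"
    unfolding case_prod_unfold pred_def
    by (intro borel_closed closed_Collect_le) (auto intro!: closed_Collect_le continuous_intros)
  have "AE (x, z, y, u) in ?H q. \<bar>y\<bar> \<le> B" for q
  proof -
    obtain x z y u where q: "q = (x, z, y, u)" by (metis surj_pair)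
    show ?thesis
      unfolding q H_eq using meas
      by (subst AE_distr_iff[OF next_meas]) (auto simp: B pred_def case_prod_unfold)
  qed
  then have "AE (x, z, y, u) in \<mu> \<bind> ?H. \<bar>y\<bar> \<le> B"
    by (subst AE_bind[OF H' meas]) simp
  then show "AE (x, z, y, u) in \<mu>. \<bar>y\<bar> \<le> B"
    unfolding \<mu>H .
qed

subsection \<open>Ridge functions and the kernel\<close>

text \<open>The factor \<open>DIM('a)\<close> comes from summing the coordinates of the gradient.
  These crude bounds serve integrability against probability measures, where sharpness is
  irrelevant.\<close>

lemma apply_c2b_bounds:
  fixes h :: "'a::euclidean_space c2b"
  shows "\<bar>apply_c2b h w\<bar> \<le> norm h" "norm (grad (apply_c2b h) w) \<le> DIM('a) * norm h"
proof -
  have h: "\<bar>apply_c2b h w\<bar> \<le> norm h" "i \<in> Basis \<Longrightarrow> \<bar>partial_deriv i (apply_c2b h) w\<bar> \<le> norm h" for i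
    using C2b_bounds[OF apply_c2b[of h]] by (simp_all add: norm_c2b.rep_eq)
  show "\<bar>apply_c2b h w\<bar> \<le> norm h" by (rule h)
  have "norm (grad (apply_c2b h) w) \<le> (\<Sum>i\<in>(Basis :: 'a set). norm h)"
    unfolding grad_def using h by (intro sum_norm_le) simp
  then show "norm (grad (apply_c2b h) w) \<le> DIM('a) * norm h" by simp
qed

lemma continuous_on_apply_c2b: "continuous_on UNIV (apply_c2b h)"
  using apply_c2b[of h] by (auto simp: C2b_def C2_def continuous_on_eq_continuous_within
    intro: differentiable_imp_continuous_within)

lemma continuous_on_grad_c2b: "continuous_on UNIV (grad (apply_c2b h))"
  unfolding grad_def using apply_c2b[of h]
  by (intro continuous_intros) (auto simp: C2b_def C2_def continuous_on_eq_continuous_within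
    intro: differentiable_imp_continuous_within)

lemma borel_measurable_c2b [measurable]:
  "apply_c2b h \<in> borel_measurable borel" "grad (apply_c2b h) \<in> borel_measurable borel"
  by (intro borel_measurable_continuous_onI continuous_on_apply_c2b continuous_on_grad_c2b)+

lemma grad_diff_c2b: "grad (apply_c2b (h - k)) w = grad (apply_c2b h) w - grad (apply_c2b k) w"
proof -
  have d: "apply_c2b h differentiable at x" for h :: "'a c2b" and x
    using apply_c2b[of h] by (auto simp: C2b_def C2_def)
  then show ?thesis
    by (simp add: grad_def minus_c2b.rep_eq partial_deriv_diff scaleR_left_diff_distrib sum_subtractf)
qed

section \<open>Size and gradient of ridge functions\<close>

context
  fixes \<sigma> :: "real \<Rightarrow> real"
  assumes \<sigma>: "\<sigma> \<in> C2b"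
begin

lemma grad_ridge:
  fixes x :: "'a::euclidean_space"
  shows "grad (apply_c2b (ridge \<sigma> x u)) w = partial_deriv 1 \<sigma> (w \<bullet> x + u) *\<^sub>R x"
proof -
  have "partial_deriv i (\<lambda>w. \<sigma> (w \<bullet> x + u)) w = (i \<bullet> x) * partial_deriv 1 \<sigma> (w \<bullet> x + u)" for i
    using partial_deriv_ridge[of \<sigma> i 1 x u] \<sigma> by (simp add: C2b_def C2_def)
  then have "grad (apply_c2b (ridge \<sigma> x u)) w
      = (\<Sum>i\<in>Basis. partial_deriv 1 \<sigma> (w \<bullet> x + u) *\<^sub>R (x \<bullet> i) *\<^sub>R i)"
    unfolding grad_def apply_ridge[OF \<sigma>] by (simp add: inner_commute mult.commute)
  also have "\<dots> = partial_deriv 1 \<sigma> (w \<bullet> x + u) *\<^sub>R x"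
    by (simp only: scaleR_sum_right[symmetric] euclidean_representation)
  finally show ?thesis .
qed

lemma activation_bounds:
  "\<bar>\<sigma> t\<bar> \<le> c2_norm \<sigma>" "\<bar>partial_deriv 1 \<sigma> t\<bar> \<le> c2_norm \<sigma>"
  "\<bar>partial_deriv 1 (partial_deriv 1 \<sigma>) t\<bar> \<le> c2_norm \<sigma>"
  using C2b_bounds[OF \<sigma>] by simp_all

lemma c2_norm_activation_nonneg: "0 \<le> c2_norm \<sigma>"
  using activation_bounds(1)[of 0] by linarith

lemma continuous_on_activation:
  "continuous_on UNIV \<sigma>" "continuous_on UNIV (partial_deriv 1 \<sigma>)"
  using \<sigma> by (auto simp: C2b_def C2_def continuous_on_eq_continuous_within
    intro: differentiable_imp_continuous_within)

lemma ridge_bounds: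
  fixes x :: "'a::euclidean_space"
  shows "\<bar>apply_c2b (ridge \<sigma> x u) w\<bar> \<le> c2_norm \<sigma>"
    and "norm (grad (apply_c2b (ridge \<sigma> x u)) w) \<le> c2_norm \<sigma> * norm x"
  using activation_bounds by (simp add: apply_ridge[OF \<sigma>]) (simp add: grad_ridge activation_bounds mult_right_mono)

text \<open>Each derivative in \<open>w\<close> brings out one coordinate of \<open>x\<close>; the
  factor \<open>(1 + norm x)\<^sup>2\<close> dominates the products of zero, one and two
  coordinates. The bound is uniform in \<open>u\<close> and over bounded \<open>x\<close>.\<close>

lemma norm_ridge_le:
  fixes x :: "'a::euclidean_space"
  shows "norm (ridge \<sigma> x u) \<le> c2_norm \<sigma> * (1 + norm x)\<^sup>2"
proof -
  let ?r = "\<lambda>w. \<sigma> (w \<bullet> x + u)" and ?A = "c2_norm \<sigma>"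
  have diff: "\<sigma> differentiable at t" "partial_deriv 1 \<sigma> differentiable at t" for t
    using \<sigma> by (auto simp: C2b_def C2_def)
  have 1: "partial_deriv i ?r = (\<lambda>w. (i \<bullet> x) * partial_deriv 1 \<sigma> (w \<bullet> x + u))" for i
    using partial_deriv_ridge[of \<sigma> i 1 x u] diff(1) by simp
  have 2: "partial_deriv j (partial_deriv i ?r)
      = (\<lambda>w. (i \<bullet> x) * (j \<bullet> x) * partial_deriv 1 (partial_deriv 1 \<sigma>) (w \<bullet> x + u))" for i j
    using partial_deriv_ridge[of "partial_deriv 1 \<sigma>" j "i \<bullet> x" x u] diff(2) by (simp add: 1)
  have i: "\<bar>i \<bullet> x\<bar> \<le> 1 + norm x" if "i \<in> Basis" for i
    using Cauchy_Schwarz_ineq2[of i x] that by simp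
  have one: "1 \<le> (1 + norm x)\<^sup>2" "1 + norm x \<le> (1 + norm x)\<^sup>2"
    by (simp_all add: power2_eq_square algebra_simps)
  have "Max (c2_jet ?r w) \<le> ?A * (1 + norm x)\<^sup>2" for w
    unfolding Max_c2_jet_le_iff 2 unfolding 1
  proof (intro conjI ballI)
    show "\<bar>?r w\<bar> \<le> ?A * (1 + norm x)\<^sup>2"
      using mult_mono[OF activation_bounds(1)[of "w \<bullet> x + u"] one(1)] c2_norm_activation_nonneg by simp
    show "\<bar>(i \<bullet> x) * partial_deriv 1 \<sigma> (w \<bullet> x + u)\<bar> \<le> ?A * (1 + norm x)\<^sup>2" if "i \<in> Basis" for i
      using mult_mono[OF activation_bounds(2)[of "w \<bullet> x + u"] order_trans[OF i[OF that] one(2)]]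
        c2_norm_activation_nonneg by (simp add: abs_mult mult.commute)
    show "\<bar>(i \<bullet> x) * (j \<bullet> x) * partial_deriv 1 (partial_deriv 1 \<sigma>) (w \<bullet> x + u)\<bar> \<le> ?A * (1 + norm x)\<^sup>2"
      if "i \<in> Basis" "j \<in> Basis" for i j
      using mult_mono[OF activation_bounds(3)[of "w \<bullet> x + u"] mult_mono[OF i[OF that(1)] i[OF that(2)]]]
        c2_norm_activation_nonneg by (simp add: abs_mult power2_eq_square mult_ac)
  qed
  then have "c2_norm ?r \<le> ?A * (1 + norm x)\<^sup>2"
    by (rule c2_norm_le)
  then show ?thesis
    by (simp add: norm_c2b.rep_eq apply_ridge[OF \<sigma>])
qed

end

definition sobolev_seminorm :: "real \<Rightarrow> 'a::euclidean_space measure \<Rightarrow> 'a c2b \<Rightarrow> real" where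
  "sobolev_seminorm c lam h = (\<integral>w. \<bar>apply_c2b h w\<bar> + c * norm (grad (apply_c2b h) w) \<partial>lam)"

section \<open>The kernel and the first-order seminorm\<close>

context
  fixes c :: real and lam :: "'a::euclidean_space measure"
  assumes c: "0 \<le> c" and lam: "prob_space lam" and sets_lam [measurable_cong]: "sets lam = sets borel"
begin

interpretation lam: prob_space lam by (rule lam)

lemma integrable_c2b:
  "integrable lam (\<lambda>w. \<bar>apply_c2b h w\<bar>)" "integrable lam (\<lambda>w. norm (grad (apply_c2b h) w))"
  using apply_c2b_bounds[of h]
  by (intro lam.integrable_const_bound[where B = "norm h"]; simp)
    (intro lam.integrable_const_bound[where B = "DIM('a) * norm h"]; simp add: apply_c2b_bounds)

lemma sobolev_seminorm_nonneg: "0 \<le> sobolev_seminorm c lam h"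
  unfolding sobolev_seminorm_def using c by (intro integral_nonneg_AE AE_I2) simp

lemma integrable_kernel:
  "integrable lam (\<lambda>w. apply_c2b h w * apply_c2b s w + c * (grad (apply_c2b h) w \<bullet> grad (apply_c2b s) w))"
proof (rule lam.integrable_const_bound[where B = "norm h * norm s + c * ((DIM('a) * norm h) * (DIM('a) * norm s))", OF AE_I2])
  show "norm (apply_c2b h w * apply_c2b s w + c * (grad (apply_c2b h) w \<bullet> grad (apply_c2b s) w))
      \<le> norm h * norm s + c * ((DIM('a) * norm h) * (DIM('a) * norm s))" for w
  proof -
    have "\<bar>apply_c2b h w * apply_c2b s w\<bar> \<le> norm h * norm s"
      unfolding abs_mult by (intro mult_mono apply_c2b_bounds) auto
    moreover have "\<bar>grad (apply_c2b h) w \<bullet> grad (apply_c2b s) w\<bar> \<le> (DIM('a) * norm h) * (DIM('a) * norm s)"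
      by (rule order_trans[OF Cauchy_Schwarz_ineq2]) (intro mult_mono apply_c2b_bounds, auto)
    ultimately show ?thesis
      using c by (intro order_trans[OF norm_triangle_ineq] add_mono) (auto simp: abs_mult mult_left_mono)
  qed
qed measurable

lemma kernel_K_diff: "kernel_K c lam (h - k) s = kernel_K c lam h s - kernel_K c lam k s"
proof -
  have "kernel_K c lam h s - kernel_K c lam k s
      = (\<integral>w. (apply_c2b h w * apply_c2b s w + c * (grad (apply_c2b h) w \<bullet> grad (apply_c2b s) w))
          - (apply_c2b k w * apply_c2b s w + c * (grad (apply_c2b k) w \<bullet> grad (apply_c2b s) w)) \<partial>lam)"
    unfolding kernel_K_def
    by (rule Bochner_Integration.integral_diff[symmetric]) (rule integrable_kernel)+
  also have "\<dots> = kernel_K c lam (h - k) s"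
    unfolding kernel_K_def
    unfolding grad_diff_c2b by (simp add: minus_c2b.rep_eq algebra_simps inner_diff_left)
  finally show ?thesis ..
qed

context
  fixes \<sigma> :: "real \<Rightarrow> real"
  assumes \<sigma>: "\<sigma> \<in> C2b"
begin

lemma sobolev_seminorm_ridge_le:
  "sobolev_seminorm c lam (ridge \<sigma> x u) \<le> c2_norm \<sigma> * (1 + c * norm x)"
  unfolding sobolev_seminorm_def
proof (rule lam.integral_le_const[OF _ AE_I2])
  show "integrable lam (\<lambda>w. \<bar>apply_c2b (ridge \<sigma> x u) w\<bar> + c * norm (grad (apply_c2b (ridge \<sigma> x u)) w))"
    using integrable_c2b by simp
  show "\<bar>apply_c2b (ridge \<sigma> x u) w\<bar> + c * norm (grad (apply_c2b (ridge \<sigma> x u)) w) \<le> c2_norm \<sigma> * (1 + c * norm x)" for w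
    using ridge_bounds[OF \<sigma>, of x u w] mult_left_mono[OF ridge_bounds(2)[OF \<sigma>, of x u w] c]
    by (simp add: algebra_simps)
qed

text \<open>The ridge function and its gradient are bounded pointwise and leave the integral as
  constants. What remains is the integral of \<open>h\<close> and its gradient, so the weak seminorm
  of \<open>h\<close> suffices in place of its norm in \<open>C2b\<close>.\<close>

lemma kernel_K_ridge_le:
  "\<bar>kernel_K c lam h (ridge \<sigma> x u)\<bar> \<le> c2_norm \<sigma> * (1 + norm x) * sobolev_seminorm c lam h"
proof -
  let ?A = "c2_norm \<sigma>" and ?h = "apply_c2b h" and ?s = "apply_c2b (ridge \<sigma> x u)"
  have A: "0 \<le> ?A" by (rule c2_norm_activation_nonneg[OF \<sigma>])
  have "\<bar>kernel_K c lam h (ridge \<sigma> x u)\<bar> \<le> (\<integral>w. \<bar>?h w * ?s w + c * (grad ?h w \<bullet> grad ?s w)\<bar> \<partial>lam)"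
    unfolding kernel_K_def by (rule integral_abs_bound)
  also have "\<dots> \<le> (\<integral>w. ?A * (1 + norm x) * (\<bar>?h w\<bar> + c * norm (grad ?h w)) \<partial>lam)"
  proof (rule integral_mono)
    fix w
    have "\<bar>?h w * ?s w\<bar> \<le> \<bar>?h w\<bar> * (?A * (1 + norm x))"
      unfolding abs_mult using ridge_bounds(1)[OF \<sigma>, of x u w] A
      by (intro mult_left_mono) (auto simp: algebra_simps intro: add_increasing2)
    moreover have "\<bar>grad ?h w \<bullet> grad ?s w\<bar> \<le> norm (grad ?h w) * (?A * (1 + norm x))"
      using ridge_bounds(2)[OF \<sigma>, of x u w] A
      by (intro order_trans[OF Cauchy_Schwarz_ineq2] mult_left_mono) (auto simp: algebra_simps)
    ultimately have "\<bar>?h w * ?s w + c * (grad ?h w \<bullet> grad ?s w)\<bar>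
        \<le> \<bar>?h w\<bar> * (?A * (1 + norm x)) + c * (norm (grad ?h w) * (?A * (1 + norm x)))"
      using c by (intro order_trans[OF abs_triangle_ineq] add_mono) (auto simp: abs_mult mult_left_mono)
    then show "\<bar>?h w * ?s w + c * (grad ?h w \<bullet> grad ?s w)\<bar>
        \<le> ?A * (1 + norm x) * (\<bar>?h w\<bar> + c * norm (grad ?h w))"
      by (simp add: algebra_simps)
  qed (use integrable_kernel integrable_c2b in \<open>auto intro!: integrable_abs\<close>)
  also have "\<dots> = ?A * (1 + norm x) * sobolev_seminorm c lam h"
    unfolding sobolev_seminorm_def by simp
  finally show ?thesis .
qed

text \<open>Only \<sigma> and its first derivative occur, and both are continuous and bounded. For
  fixed \<open>w\<close> the integrand tends to zero, and dominated convergence replaces uniformity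
  in \<open>w\<close>, which fails for unbounded \<open>w\<close>.\<close>

lemma sobolev_seminorm_ridge_tendsto:
  assumes x: "x \<longlonglongrightarrow> x0" and u: "u \<longlonglongrightarrow> u0"
  shows "(\<lambda>n. sobolev_seminorm c lam (ridge \<sigma> (x n) (u n) - ridge \<sigma> x0 u0)) \<longlonglongrightarrow> 0"
proof -
  let ?A = "c2_norm \<sigma>"
  let ?d = "\<lambda>n w. \<bar>\<sigma> (w \<bullet> x n + u n) - \<sigma> (w \<bullet> x0 + u0)\<bar> +
      c * norm (partial_deriv 1 \<sigma> (w \<bullet> x n + u n) *\<^sub>R x n - partial_deriv 1 \<sigma> (w \<bullet> x0 + u0) *\<^sub>R x0)"
  have A: "0 \<le> ?A" by (rule c2_norm_activation_nonneg[OF \<sigma>])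
  obtain B where B: "\<And>n. norm (x n) \<le> B"
    using convergent_imp_Bseq[OF convergentI[OF x]] by (auto simp: Bseq_def)
  have cont: "isCont \<sigma> t" "isCont (partial_deriv 1 \<sigma>) t" for t
    using continuous_on_activation[OF \<sigma>] by (auto simp: continuous_on_eq_continuous_at)
  have "(\<lambda>n. \<integral>w. ?d n w \<partial>lam) \<longlonglongrightarrow> (\<integral>w. 0 \<partial>lam)"
  \<comment> \<open>The term \<open>2 * ?A\<close> dominates the two values of \<sigma>; the other
    two terms dominate the gradients, with \<open>B\<close> bounding the convergent sequence
    \<open>x\<close>.\<close>
  proof (rule integral_dominated_convergence[where w = "\<lambda>_. 2 * ?A + c * (?A * B + ?A * norm x0)"])
    have [measurable]: "\<sigma> \<in> borel_measurable borel" "partial_deriv 1 \<sigma> \<in> borel_measurable borel"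
      using continuous_on_activation[OF \<sigma>] by (auto intro: borel_measurable_continuous_onI)
    show "?d n \<in> borel_measurable lam" for n by measurable
    show "AE w in lam. (\<lambda>n. ?d n w) \<longlonglongrightarrow> 0"
    proof (rule AE_I2)
      fix w
      have wxu: "(\<lambda>n. w \<bullet> x n + u n) \<longlonglongrightarrow> w \<bullet> x0 + u0"
        by (intro tendsto_intros x u)
      have "(\<lambda>n. ?d n w) \<longlonglongrightarrow> \<bar>\<sigma> (w \<bullet> x0 + u0) - \<sigma> (w \<bullet> x0 + u0)\<bar> +
          c * norm (partial_deriv 1 \<sigma> (w \<bullet> x0 + u0) *\<^sub>R x0 - partial_deriv 1 \<sigma> (w \<bullet> x0 + u0) *\<^sub>R x0)"
        by (intro tendsto_intros x isCont_tendsto_compose[OF cont(1) wxu] isCont_tendsto_compose[OF cont(2) wxu])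
      then show "(\<lambda>n. ?d n w) \<longlonglongrightarrow> 0" by simp
    qed
    show "AE w in lam. norm (?d n w) \<le> 2 * ?A + c * (?A * B + ?A * norm x0)" for n
    proof (rule AE_I2)
      fix w
      let ?e = "partial_deriv 1 \<sigma> (w \<bullet> x n + u n) *\<^sub>R x n - partial_deriv 1 \<sigma> (w \<bullet> x0 + u0) *\<^sub>R x0"
      have "norm ?e \<le> ?A * B + ?A * norm x0"
        using A B[of n] activation_bounds(2)[OF \<sigma>]
        by (intro order_trans[OF norm_triangle_ineq4] add_mono) (auto intro!: mult_mono)
      then have "c * norm ?e \<le> c * (?A * B + ?A * norm x0)" "0 \<le> c * norm ?e"
        using c by (simp_all add: mult_left_mono)
      moreover have "\<bar>\<sigma> (w \<bullet> x n + u n) - \<sigma> (w \<bullet> x0 + u0)\<bar> \<le> 2 * ?A"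
        using activation_bounds(1)[OF \<sigma>, of "w \<bullet> x n + u n"] activation_bounds(1)[OF \<sigma>, of "w \<bullet> x0 + u0"]
        by linarith
      ultimately show "norm (?d n w) \<le> 2 * ?A + c * (?A * B + ?A * norm x0)"
        unfolding real_norm_def by linarith
    qed
  qed simp_all
  then show ?thesis
    unfolding sobolev_seminorm_def grad_diff_c2b grad_ridge[OF \<sigma>]
    by (simp add: minus_c2b.rep_eq apply_ridge[OF \<sigma>])
qed

text \<open>Used for two functionals, the flow \<open>g t\<close> and its time derivative.
  Compatibility with differences is the part of linearity that sequential continuity calls
  for.\<close>

lemma continuous_on_ridge_functional:
  fixes \<phi> :: "'a c2b \<Rightarrow> real"
  assumes diff: "\<And>h k. \<phi> (h - k) = \<phi> h - \<phi> k"
    and le: "\<And>h. \<bar>\<phi> h\<bar> \<le> C * sobolev_seminorm c lam h"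
  shows "continuous_on UNIV (\<lambda>(x, u). \<phi> (ridge \<sigma> x u))"
proof (rule continuous_on_sequentiallyI)
  fix p :: "nat \<Rightarrow> 'a \<times> real" and q
  assume p: "p \<longlonglongrightarrow> q"
  let ?r = "\<lambda>p. ridge \<sigma> (fst p) (snd p)"
  have "(\<lambda>n. C * sobolev_seminorm c lam (?r (p n) - ?r q)) \<longlonglongrightarrow> 0"
    by (rule tendsto_mult_right_zero
        [OF sobolev_seminorm_ridge_tendsto[OF tendsto_fst[OF p] tendsto_snd[OF p]]])
  moreover have "\<forall>\<^sub>F n in sequentially. norm (\<phi> (?r (p n)) - \<phi> (?r q))
      \<le> C * sobolev_seminorm c lam (?r (p n) - ?r q)"
    unfolding diff[symmetric] real_norm_def by (intro always_eventually allI le)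
  ultimately have "(\<lambda>n. \<phi> (?r (p n)) - \<phi> (?r q)) \<longlonglongrightarrow> 0"
    by (rule Lim_null_comparison[rotated])
  then show "(\<lambda>n. case p n of (x, u) \<Rightarrow> \<phi> (ridge \<sigma> x u)) \<longlonglongrightarrow> (case q of (x, u) \<Rightarrow> \<phi> (ridge \<sigma> x u))"
    by (simp add: LIM_zero_iff case_prod_unfold)
qed

end

end

text \<open>A Gram kernel is positive semidefinite: pulling both integrals over \<mu> inside turns
  the expression into the integral over \<open>lam\<close> of the squared norm of the mean feature
  \<open>\<Psi>\<close>. Boundedness of \<open>\<Phi>\<close> licenses both uses of Fubini's
  theorem.\<close>

lemma feature_kernel_nonneg:
  fixes \<Phi> :: "'p \<Rightarrow> 'w \<Rightarrow> 'c::euclidean_space"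
  assumes "prob_space \<mu>" "prob_space lam"
    and meas[measurable]: "case_prod \<Phi> \<in> borel_measurable (\<mu> \<Otimes>\<^sub>M lam)"
    and B: "\<And>p w. norm (\<Phi> p w) \<le> B"
  shows "(\<integral>p. (\<integral>q. (\<integral>w. \<Phi> p w \<bullet> \<Phi> q w \<partial>lam) \<partial>\<mu>) \<partial>\<mu>) \<ge> 0"
proof -
  interpret \<mu>: prob_space \<mu> by fact
  interpret lam: prob_space lam by fact
  interpret pair_prob_space \<mu> lam ..
  define \<Psi> where "\<Psi> w = (\<integral>p. \<Phi> p w \<partial>\<mu>)" for w
  have B0: "0 \<le> B" using B[of undefined undefined] norm_ge_zero order_trans by blast
  have inner_le: "\<bar>v \<bullet> v'\<bar> \<le> B * B" if "norm v \<le> B" "norm v' \<le> B" for v v' :: 'c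
    using Cauchy_Schwarz_ineq2[of v v'] mult_mono[OF that B0] by simp
  have [measurable]: "(\<lambda>(w, p). \<Phi> p w) \<in> borel_measurable (lam \<Otimes>\<^sub>M \<mu>)"
    by (subst measurable_pair_swap_iff) (simp add: case_prod_unfold)
  have \<Phi>_meas[measurable]: "(\<lambda>w. \<Phi> p w) \<in> borel_measurable lam" if "p \<in> space \<mu>" for p
    using measurable_Pair2[OF meas that] by simp
  have \<Phi>_meas'[measurable]: "(\<lambda>p. \<Phi> p w) \<in> borel_measurable \<mu>" if "w \<in> space lam" for w
    using measurable_Pair1[OF meas that] by simp
  have [measurable]: "\<Psi> \<in> borel_measurable lam"
    unfolding \<Psi>_def by measurable
  have int_\<Phi>: "integrable \<mu> (\<lambda>p. \<Phi> p w)" if "w \<in> space lam" for w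
    using that by (intro \<mu>.integrable_const_bound[where B = B]) (auto simp: B)
  have \<Psi>_le: "norm (\<Psi> w) \<le> B" if "w \<in> space lam" for w
  proof -
    have "norm (\<Psi> w) \<le> (\<integral>p. norm (\<Phi> p w) \<partial>\<mu>)"
      unfolding \<Psi>_def by (rule integral_norm_bound)
    also have "\<dots> \<le> B"
      using int_\<Phi>[OF that] by (intro \<mu>.integral_le_const) (auto simp: B)
    finally show ?thesis .
  qed
  have inner: "(\<integral>q. (\<integral>w. \<Phi> p w \<bullet> \<Phi> q w \<partial>lam) \<partial>\<mu>) = (\<integral>w. \<Phi> p w \<bullet> \<Psi> w \<partial>lam)"
    if p: "p \<in> space \<mu>" for p
  proof -
    have "integrable (\<mu> \<Otimes>\<^sub>M lam) (\<lambda>(q, w). \<Phi> p w \<bullet> \<Phi> q w)"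
      using p by (intro integrable_const_bound[where B = "B * B"]) (auto intro!: inner_le B)
    from Fubini_integral[OF this]
    have "(\<integral>q. (\<integral>w. \<Phi> p w \<bullet> \<Phi> q w \<partial>lam) \<partial>\<mu>) = (\<integral>w. (\<integral>q. \<Phi> p w \<bullet> \<Phi> q w \<partial>\<mu>) \<partial>lam)"
      by simp
    also have "\<dots> = (\<integral>w. \<Phi> p w \<bullet> \<Psi> w \<partial>lam)"
      unfolding \<Psi>_def by (intro Bochner_Integration.integral_cong refl) (simp add: int_\<Phi>)
    finally show ?thesis .
  qed
  have "integrable (\<mu> \<Otimes>\<^sub>M lam) (\<lambda>(p, w). \<Phi> p w \<bullet> \<Psi> w)"
    by (intro integrable_const_bound[where B = "B * B"])
      (auto simp: space_pair_measure intro!: inner_le B \<Psi>_le AE_I2)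
  from Fubini_integral[OF this]
  have "(\<integral>p. (\<integral>w. \<Phi> p w \<bullet> \<Psi> w \<partial>lam) \<partial>\<mu>) = (\<integral>w. (\<integral>p. \<Phi> p w \<bullet> \<Psi> w \<partial>\<mu>) \<partial>lam)"
    by simp
  also have "\<dots> = (\<integral>w. \<Psi> w \<bullet> \<Psi> w \<partial>lam)"
    by (intro Bochner_Integration.integral_cong refl) (simp add: int_\<Phi> \<Psi>_def)
  also have "\<dots> \<ge> 0"
    by (intro integral_nonneg_AE AE_I2) simp
  finally show ?thesis
    by (simp add: inner cong: Bochner_Integration.integral_cong)
qed

subsection \<open>The flow\<close>

text \<open>\<open>T\<close> lies strictly to the right of \<open>t\<close>, so the remainder
  estimate is demanded on a bounded stretch only. The set \<open>S\<close> allows a one-sided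
  derivative, as at time 0.\<close>

lemma has_real_derivative_quadratic_remainder:
  fixes E :: "real \<Rightarrow> real"
  assumes "t < T"
    and le: "\<And>s. s \<in> S \<Longrightarrow> s < T \<Longrightarrow> \<bar>E s - E t - D * (s - t)\<bar> \<le> C * (s - t)\<^sup>2"
  shows "(E has_real_derivative D) (at t within S)"
  unfolding has_field_derivative_iff
proof (rule LIM_zero_cancel, rule Lim_null_comparison)
  have "((\<lambda>s. C * \<bar>s - t\<bar>) \<longlongrightarrow> C * \<bar>t - t\<bar>) (at t within S)"
    by (intro tendsto_intros)
  then show "((\<lambda>s. C * \<bar>s - t\<bar>) \<longlongrightarrow> 0) (at t within S)" by simp
  have "\<forall>\<^sub>F s in at t within S. s < T"
    using order_tendstoD(2)[OF tendsto_ident_at \<open>t < T\<close>] .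
  moreover have "\<forall>\<^sub>F s in at t within S. s \<in> S \<and> s \<noteq> t"
    by (auto simp: eventually_at_filter)
  ultimately show "\<forall>\<^sub>F s in at t within S. norm ((E s - E t) / (s - t) - D) \<le> C * \<bar>s - t\<bar>"
  proof eventually_elim
    case (elim s)
    then have "(E s - E t) / (s - t) - D = (E s - E t - D * (s - t)) / (s - t)"
      by (simp add: field_simps)
    moreover have "\<bar>E s - E t - D * (s - t)\<bar> / \<bar>s - t\<bar> \<le> C * (s - t)\<^sup>2 / \<bar>s - t\<bar>"
      using le elim by (intro divide_right_mono) auto
    moreover have "C * (s - t)\<^sup>2 / \<bar>s - t\<bar> = C * \<bar>s - t\<bar>"
      using elim by (simp add: power2_eq_square abs_if field_simps)
    ultimately show ?case by (simp add: abs_divide)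
  qed
qed

text \<open>The constant \<open>c\<close> is a guess for the integrand: \<open>c = 0\<close> gives
  Lipschitz bounds in time, and a value of the integrand between \<open>a\<close> and
  \<open>b\<close> gives a first-order expansion.\<close>

lemma set_integral_diff_bound:
  fixes F :: "real \<Rightarrow> real"
  assumes int: "set_integrable lborel {0..b} F" and ab: "0 \<le> a" "a \<le> b" and "0 \<le> E"
    and le: "\<And>s. a \<le> s \<Longrightarrow> s \<le> b \<Longrightarrow> \<bar>F s - c\<bar> \<le> E"
  shows "\<bar>(LBINT s:{0..b}. F s) - (LBINT s:{0..a}. F s) - c * (b - a)\<bar> \<le> E * (b - a)"
proof -
  have F: "F integrable_on {0..b}"
    and eq: "(LBINT s:{0..b}. F s) = integral {0..b} F" "(LBINT s:{0..a}. F s) = integral {0..a} F"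
    using set_borel_integral_eq_integral[OF int]
      set_borel_integral_eq_integral(2)[OF set_integrable_subset[OF int], of "{0..a}"] ab by auto
  have "integral {0..a} F + integral {a..b} F = integral {0..b} F"
    using ab F by (intro Henstock_Kurzweil_Integration.integral_combine) auto
  moreover have Fab: "F integrable_on {a..b}"
    using integrable_subinterval_real[OF F] ab by simp
  moreover have "\<bar>integral {a..b} F - c * (b - a)\<bar> \<le> E * (b - a)"
  proof -
    have "((\<lambda>s. F s - c) has_integral (integral {a..b} F - (b - a) *\<^sub>R c)) {a..b}"
      using Fab has_integral_const_real[of c a b] ab
      by (intro has_integral_diff) (auto simp: integrable_integral)
    then have "norm (integral {a..b} F - (b - a) *\<^sub>R c) \<le> E * measure lborel {a..b}"
      using \<open>0 \<le> E\<close> le by (intro has_integral_bound_real[where f = "\<lambda>s. F s - c"]) auto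
    then show ?thesis using ab by (simp add: mult.commute)
  qed
  ultimately show ?thesis by (simp add: eq algebra_simps)
qed

text \<open>The setting for the flow argument: the chain is represented by the almost sure bounds
  \<open>supp\<close> on inputs and outputs, and \<open>c\<close> stands for the gradient weight of
  the kernel.\<close>

locale memory_flow =
  fixes \<alpha> c Cx Cy :: real and lam :: "'a::euclidean_space measure" and \<sigma> :: "real \<Rightarrow> real"
    and \<mu> :: "('a \<times> 'b::euclidean_space \<times> real \<times> real) measure"
    and g :: "real \<Rightarrow> 'a c2b \<Rightarrow>\<^sub>L real"
  assumes \<alpha>: "0 < \<alpha>" and c: "0 < c" and Cx: "0 \<le> Cx"
    and \<sigma>: "\<sigma> \<in> C2b"
    and lam: "prob_space lam" and sets_lam [measurable_cong]: "sets lam = sets borel"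
    and \<mu>: "prob_space \<mu>" and sets_\<mu> [measurable_cong]: "sets \<mu> = sets borel"
    and supp: "AE (x, z, y, u) in \<mu>. norm x \<le> Cx \<and> \<bar>y\<bar> \<le> Cy"
    and flow: "flow_solution \<alpha> c lam \<sigma> \<mu> g"
begin

sublocale lam: prob_space lam by (rule lam)
sublocale \<mu>: prob_space \<mu> by (rule \<mu>)

definition feature :: "'a \<times> 'b \<times> real \<times> real \<Rightarrow> 'a c2b" where
  "feature = (\<lambda>(x, z, y, u). ridge \<sigma> x u)"

definition label :: "'a \<times> 'b \<times> real \<times> real \<Rightarrow> real" where
  "label = (\<lambda>(x, z, y, u). y)"

definition support_set :: "('a \<times> 'b \<times> real \<times> real) set" where
  "support_set = {(x, z, y, u). norm x \<le> Cx \<and> \<bar>y\<bar> \<le> Cy}"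

definition residual :: "real \<Rightarrow> 'a \<times> 'b \<times> real \<times> real \<Rightarrow> real" where
  "residual t p = blinfun_apply (g t) (feature p) - label p"

text \<open>By the flow equation, \<open>- \<alpha> * slope t h\<close> is the candidate for the
  time derivative of \<open>g t\<close> at \<open>h\<close>.\<close>

definition slope :: "real \<Rightarrow> 'a c2b \<Rightarrow> real" where
  "slope t h = (\<integral>p. residual t p * kernel_K c lam h (feature p) \<partial>\<mu>)"

text \<open>One constant serves both \<open>kernel_feature_le\<close> and
  \<open>N_feature_le\<close>; the factors \<open>1 + Cx\<close> and \<open>1 + c\<close> cover the
  two estimates together.\<close>

definition feature_bound :: real where
  "feature_bound = c2_norm \<sigma> * (1 + Cx) * (1 + c)"

abbreviation "N \<equiv> sobolev_seminorm c lam"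

lemma flow_integrand_eq:
  "flow_integrand c lam \<sigma> (g t) h = (\<lambda>p. residual t p * kernel_K c lam h (feature p))"
  by (auto simp: flow_integrand_def residual_def feature_def label_def)

lemma AE_support: "AE p in \<mu>. p \<in> support_set"
  using supp by (simp add: support_set_def case_prod_unfold)

lemma closed_support: "closed support_set"
  unfolding support_set_def case_prod_unfold
  by (intro closed_Collect_conj closed_Collect_le continuous_intros)

lemma measurable_label [measurable]: "label \<in> borel_measurable \<mu>"
proof -
  have "label \<in> borel_measurable borel"
    unfolding label_def case_prod_unfold
    by (intro borel_measurable_continuous_onI continuous_intros)
  then show ?thesis by (simp add: measurable_cong_sets[OF sets_\<mu> refl])
qed

lemma N_nonneg: "0 \<le> N h"
  using c by (intro sobolev_seminorm_nonneg lam sets_lam) auto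

lemma feature_bound_nonneg: "0 \<le> feature_bound"
  using c2_norm_activation_nonneg[OF \<sigma>] c Cx by (simp add: feature_bound_def)

lemma kernel_feature_le:
  assumes "p \<in> support_set"
  shows "\<bar>kernel_K c lam h (feature p)\<bar> \<le> feature_bound * N h"
proof -
  obtain x z y u where p: "p = (x, z, y, u)" by (metis surj_pair)
  have A: "0 \<le> c2_norm \<sigma>" by (rule c2_norm_activation_nonneg[OF \<sigma>])
  have "\<bar>kernel_K c lam h (feature p)\<bar> \<le> c2_norm \<sigma> * (1 + norm x) * N h"
    unfolding p feature_def prod.case using c by (intro kernel_K_ridge_le lam sets_lam \<sigma>) auto
  also have "\<dots> \<le> feature_bound * N h"
  proof (rule mult_right_mono[OF _ N_nonneg])
    have "c2_norm \<sigma> * (1 + norm x) \<le> c2_norm \<sigma> * (1 + Cx)"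
      using assms A by (intro mult_left_mono) (auto simp: p support_set_def)
    also have "\<dots> \<le> feature_bound"
      unfolding feature_bound_def using A c Cx mult_left_mono[of 1 "1 + c" "c2_norm \<sigma> * (1 + Cx)"] by simp
    finally show "c2_norm \<sigma> * (1 + norm x) \<le> feature_bound" .
  qed
  finally show ?thesis .
qed

lemma N_feature_le:
  assumes "p \<in> support_set"
  shows "N (feature p) \<le> feature_bound"
proof -
  obtain x z y u where p: "p = (x, z, y, u)" by (metis surj_pair)
  have A: "0 \<le> c2_norm \<sigma>" by (rule c2_norm_activation_nonneg[OF \<sigma>])
  have x: "norm x \<le> Cx" using assms by (simp add: p support_set_def)
  have "N (feature p) \<le> c2_norm \<sigma> * (1 + c * norm x)"
    unfolding p feature_def prod.case using c by (intro sobolev_seminorm_ridge_le lam sets_lam \<sigma>) auto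
  also have "\<dots> \<le> c2_norm \<sigma> * ((1 + Cx) * (1 + c))"
  proof (rule mult_left_mono[OF _ A])
    have "c * norm x \<le> c * Cx" using x c by (intro mult_left_mono) auto
    moreover have "(1 + Cx) * (1 + c) = 1 + c * Cx + (c + Cx)" by (simp add: algebra_simps)
    ultimately show "1 + c * norm x \<le> (1 + Cx) * (1 + c)" using c Cx by linarith
  qed
  finally show ?thesis by (simp add: feature_bound_def mult.assoc)
qed

section \<open>A priori bounds from the integral equation\<close>

lemma slope_integrable:
  assumes "0 \<le> t"
  shows "integrable \<mu> (\<lambda>p. residual t p * kernel_K c lam h (feature p))"
  using flow assms by (auto simp: flow_solution_def flow_integrand_eq[symmetric])

lemma slope_set_integrable: "0 \<le> t \<Longrightarrow> set_integrable lborel {0..t} (\<lambda>s. slope s h)"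
  using flow by (auto simp: flow_solution_def flow_integrand_eq slope_def)

lemma flow_eq: "0 \<le> t \<Longrightarrow> blinfun_apply (g t) h = - \<alpha> * (LBINT s:{0..t}. slope s h)"
  using flow by (auto simp: flow_solution_def flow_integrand_eq slope_def)

lemma flow_0: "blinfun_apply (g 0) h = 0"
  using flow by (auto simp: flow_solution_def)

lemma slope_diff: "0 \<le> t \<Longrightarrow> slope t (h - k) = slope t h - slope t k"
  unfolding slope_def
  using c by (subst Bochner_Integration.integral_diff[symmetric])
    (auto simp: slope_integrable kernel_K_diff[OF _ lam sets_lam] right_diff_distrib)

text \<open>For each fixed \<open>h\<close>, integrability in time bounds \<open>g t\<close> at
  \<open>h\<close> by the integral of \<open>\<bar>slope s h\<bar>\<close> over the whole of
  \<open>{0..T}\<close>, independently of \<open>t\<close>. Uniform boundedness makes this uniform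
  in \<open>h\<close>, with no appeal to continuity of \<open>g\<close> in time.\<close>

lemma norm_flow_bounded: "\<exists>G. \<forall>t\<in>{0..T}. norm (g t) \<le> G"
proof -
  have "\<exists>B. \<forall>\<phi>\<in>g ` {0..T}. norm (blinfun_apply \<phi> h) \<le> B" for h
  proof (intro exI ballI)
    fix \<phi> assume "\<phi> \<in> g ` {0..T}"
    then obtain t where t: "0 \<le> t" "t \<le> T" and \<phi>: "\<phi> = g t" by auto
    have sub: "set_integrable lborel {0..t} (\<lambda>s. slope s h)"
      and int: "set_integrable lborel {0..T} (\<lambda>s. slope s h)"
      using t slope_set_integrable by auto
    have "norm (LBINT s:{0..t}. slope s h) \<le> (LBINT s:{0..t}. norm (slope s h))"
      using sub by (intro set_integral_norm_bound)
    also have "\<dots> \<le> (LBINT s:{0..T}. norm (slope s h))"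
      using t set_integrable_norm[OF int] set_integrable_norm[OF sub]
      unfolding set_lebesgue_integral_def set_integrable_def
      by (intro integral_mono) (auto simp: indicator_def)
    finally show "norm (blinfun_apply \<phi> h) \<le> \<alpha> * (LBINT s:{0..T}. norm (slope s h))"
      using \<alpha> t by (simp add: \<phi> flow_eq abs_mult)
  qed
  then have "\<exists>G. \<forall>\<phi>\<in>g ` {0..T}. norm \<phi> \<le> G"
    by (rule uniform_boundedness)
  then show ?thesis by auto
qed

lemma residual_bounded: "\<exists>R\<ge>0. \<forall>t\<in>{0..T}. \<forall>p\<in>support_set. \<bar>residual t p\<bar> \<le> R"
proof -
  obtain G where G: "\<And>t. t \<in> {0..T} \<Longrightarrow> norm (g t) \<le> G"
    using norm_flow_bounded by blast
  \<comment> \<open>Absolute values keep the bound nonnegative whatever the signs of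
    \<open>G\<close> and \<open>Cy\<close>; for an empty \<open>{0..T}\<close> nothing prevents
    \<open>G\<close> from being negative.\<close>
  let ?R = "\<bar>G\<bar> * (c2_norm \<sigma> * (1 + Cx)\<^sup>2) + \<bar>Cy\<bar>"
  have "\<bar>residual t p\<bar> \<le> ?R" if t: "t \<in> {0..T}" and p: "p \<in> support_set" for t p
  proof -
    obtain x z y u where p_eq: "p = (x, z, y, u)" by (metis surj_pair)
    have x: "norm x \<le> Cx" and y: "\<bar>y\<bar> \<le> Cy" using p by (auto simp: p_eq support_set_def)
    have "norm (ridge \<sigma> x u) \<le> c2_norm \<sigma> * (1 + norm x)\<^sup>2"
      by (rule norm_ridge_le[OF \<sigma>])
    also have "\<dots> \<le> c2_norm \<sigma> * (1 + Cx)\<^sup>2"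
      using x c2_norm_activation_nonneg[OF \<sigma>] by (intro mult_left_mono power_mono) auto
    finally have r: "norm (ridge \<sigma> x u) \<le> c2_norm \<sigma> * (1 + Cx)\<^sup>2" .
    have "\<bar>blinfun_apply (g t) (ridge \<sigma> x u)\<bar> \<le> norm (g t) * norm (ridge \<sigma> x u)"
      using norm_blinfun[of "g t" "ridge \<sigma> x u"] by simp
    also have "\<dots> \<le> \<bar>G\<bar> * (c2_norm \<sigma> * (1 + Cx)\<^sup>2)"
      using G[OF t] r by (intro mult_mono) auto
    finally show ?thesis
      using y by (simp add: residual_def feature_def label_def p_eq)
  qed
  moreover have "0 \<le> ?R"
    using c2_norm_activation_nonneg[OF \<sigma>] by simp
  ultimately show ?thesis by blast
qed

lemma AE_integral_le:
  fixes F :: "'a \<times> 'b \<times> real \<times> real \<Rightarrow> real"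
  assumes "integrable \<mu> F" "\<And>p. p \<in> support_set \<Longrightarrow> \<bar>F p\<bar> \<le> B"
  shows "\<bar>\<integral>p. F p \<partial>\<mu>\<bar> \<le> B"
proof -
  have "\<bar>\<integral>p. F p \<partial>\<mu>\<bar> \<le> (\<integral>p. \<bar>F p\<bar> \<partial>\<mu>)"
    by (rule integral_abs_bound)
  also have "\<dots> \<le> B"
    using assms AE_support by (intro \<mu>.integral_le_const) (auto elim: eventually_mono)
  finally show ?thesis .
qed

lemma slope_le:
  assumes "\<forall>p\<in>support_set. \<bar>residual t p\<bar> \<le> R" "0 \<le> t"
  shows "\<bar>slope t h\<bar> \<le> R * feature_bound * N h"
  unfolding slope_def mult.assoc
proof (rule AE_integral_le[OF slope_integrable[OF assms(2)]])
  fix p assume p: "p \<in> support_set"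
  then have "\<bar>residual t p\<bar> \<le> R" using assms by blast
  then show "\<bar>residual t p * kernel_K c lam h (feature p)\<bar> \<le> R * (feature_bound * N h)"
    unfolding abs_mult using kernel_feature_le[OF p] by (intro mult_mono) auto
qed

lemma flow_increment_le:
  assumes ab: "0 \<le> a" "a \<le> b" and "0 \<le> E"
    and le: "\<And>s. a \<le> s \<Longrightarrow> s \<le> b \<Longrightarrow> \<bar>slope s h - d\<bar> \<le> E"
  shows "\<bar>blinfun_apply (g b) h - blinfun_apply (g a) h + \<alpha> * d * (b - a)\<bar> \<le> \<alpha> * E * (b - a)"
proof -
  have "\<bar>(LBINT s:{0..b}. slope s h) - (LBINT s:{0..a}. slope s h) - d * (b - a)\<bar> \<le> E * (b - a)"
    using assms by (intro set_integral_diff_bound slope_set_integrable) auto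
  moreover have "blinfun_apply (g b) h - blinfun_apply (g a) h + \<alpha> * d * (b - a)
      = - (\<alpha> * ((LBINT s:{0..b}. slope s h) - (LBINT s:{0..a}. slope s h) - d * (b - a)))"
    using ab by (simp add: flow_eq algebra_simps)
  ultimately show ?thesis
    using \<alpha> by (simp only: abs_minus abs_mult) (simp add: mult.assoc)
qed

lemma continuous_on_flow_feature:
  assumes "0 \<le> t"
  shows "continuous_on UNIV (\<lambda>p. blinfun_apply (g t) (feature p))"
    and "continuous_on UNIV (\<lambda>p. slope t (feature p))"
proof -
  have cont: "continuous_on UNIV (\<lambda>p. \<phi> (feature p))"
    if "\<And>h k. \<phi> (h - k) = \<phi> h - \<phi> k" "\<And>h. \<bar>\<phi> h\<bar> \<le> C * N h" for \<phi> C
  proof -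
    have "continuous_on UNIV (\<lambda>(x, u). \<phi> (ridge \<sigma> x u))"
      using c that by (intro continuous_on_ridge_functional[where c = c and C = C, OF _ lam sets_lam \<sigma>]) auto
    then have "continuous_on UNIV (\<lambda>p :: 'a \<times> 'b \<times> real \<times> real.
        (\<lambda>(x, u). \<phi> (ridge \<sigma> x u)) (fst p, snd (snd (snd p))))"
      by (rule continuous_on_compose2) (auto intro!: continuous_intros)
    then show ?thesis by (simp add: feature_def case_prod_unfold)
  qed
  obtain R where R: "0 \<le> R" "\<And>s. s \<in> {0..t} \<Longrightarrow> \<forall>p\<in>support_set. \<bar>residual s p\<bar> \<le> R"
    using residual_bounded by blast
  have le: "\<bar>slope s h\<bar> \<le> R * feature_bound * N h" if "s \<in> {0..t}" for s h
    using slope_le[OF R(2)[OF that]] that by auto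
  show "continuous_on UNIV (\<lambda>p. slope t (feature p))"
    using assms by (intro cont[OF slope_diff le]) auto
  \<comment> \<open>Integrating the slope bound from time 0, where \<open>g\<close> vanishes, bounds
    \<open>g t\<close> by the seminorm \<open>N\<close>; continuity on ridge functions then
    follows.\<close>
  have "\<bar>blinfun_apply (g t) h\<bar> \<le> \<alpha> * R * feature_bound * t * N h" for h
    using flow_increment_le[of 0 t "R * feature_bound * N h" h 0] assms le R(1) N_nonneg feature_bound_nonneg
    by (simp add: flow_0 mult_ac)
  then show "continuous_on UNIV (\<lambda>p. blinfun_apply (g t) (feature p))"
    by (intro cont) (simp_all add: blinfun.diff_right)
qed

lemma measurable_flow_feature:
  assumes "0 \<le> t"
  shows "residual t \<in> borel_measurable \<mu>" and "(\<lambda>p. slope t (feature p)) \<in> borel_measurable \<mu>"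
proof -
  have [measurable]: "(\<lambda>p. blinfun_apply (g t) (feature p)) \<in> borel_measurable \<mu>"
    using borel_measurable_continuous_onI[OF continuous_on_flow_feature(1)[OF assms]]
    by (simp add: measurable_cong_sets[OF sets_\<mu> refl])
  show "residual t \<in> borel_measurable \<mu>"
    unfolding residual_def[abs_def] by measurable
  show "(\<lambda>p. slope t (feature p)) \<in> borel_measurable \<mu>"
    using borel_measurable_continuous_onI[OF continuous_on_flow_feature(2)[OF assms]]
    by (simp add: measurable_cong_sets[OF sets_\<mu> refl])
qed

text \<open>The bootstrap: a bounded residual bounds the slope, hence the residual is Lipschitz in
  time, hence so is the slope, hence the residual has a first-order expansion with quadratic
  remainder. All constants are uniform over \<open>support_set\<close>.\<close>

lemma flow_linearization:
  assumes "0 \<le> T"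
  shows "\<exists>R C1 C2. 0 \<le> C1 \<and> 0 \<le> C2 \<and> 0 \<le> R \<and> (\<forall>s\<in>{0..T}. \<forall>t\<in>{0..T}. \<forall>p\<in>support_set.
    \<bar>residual t p\<bar> \<le> R \<and> \<bar>slope t (feature p)\<bar> \<le> C1 \<and>
    \<bar>residual s p - residual t p\<bar> \<le> C1 * \<bar>s - t\<bar> \<and>
    \<bar>residual s p - residual t p + \<alpha> * slope t (feature p) * (s - t)\<bar> \<le> C2 * (s - t)\<^sup>2)"
proof -
  let ?B = feature_bound
  have B: "0 \<le> ?B" by (rule feature_bound_nonneg)
  obtain R where R: "0 \<le> R" "\<And>s. s \<in> {0..T} \<Longrightarrow> \<forall>p\<in>support_set. \<bar>residual s p\<bar> \<le> R"
    using residual_bounded by blast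
  \<comment> \<open>The Lipschitz constant of the residual: \<alpha> times the slope bound
    \<open>R * ?B * N h\<close>, with \<open>N h \<le> ?B\<close> at features.\<close>
  define K where "K = \<alpha> * R * ?B * ?B"
  have K: "0 \<le> K" using R \<alpha> B by (simp add: K_def)
  have slope: "\<bar>slope s h\<bar> \<le> R * ?B * N h" if "s \<in> {0..T}" for s h
    using slope_le[OF R(2)[OF that]] that by auto
  have slope_feature: "\<bar>slope s (feature p)\<bar> \<le> R * ?B * ?B" if "s \<in> {0..T}" "p \<in> support_set" for s p
    using slope[OF that(1)] mult_left_mono[OF N_feature_le[OF that(2)], of "R * ?B"] R B
    by (meson mult_nonneg_nonneg order_trans)
  have inc': "\<bar>residual b p - residual a p\<bar> \<le> K * (b - a)"
    if "0 \<le> a" "a \<le> b" "b \<le> T" "p \<in> support_set" for a b p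
    using flow_increment_le[of a b "R * ?B * ?B" "feature p" 0] that slope_feature R B
    by (simp add: residual_def K_def mult.assoc)
  have inc: "\<bar>residual b p - residual a p\<bar> \<le> K * \<bar>b - a\<bar>"
    if "a \<in> {0..T}" "b \<in> {0..T}" "p \<in> support_set" for a b p
    using inc'[of a b p] inc'[of b a p] that by (cases "a \<le> b") (auto simp: abs_minus_commute)
  have slope_inc: "\<bar>slope b h - slope a h\<bar> \<le> K * \<bar>b - a\<bar> * (?B * N h)"
    if "a \<in> {0..T}" "b \<in> {0..T}" for a b h
  proof -
    have int: "integrable \<mu> (\<lambda>p. residual b p * kernel_K c lam h (feature p))"
      "integrable \<mu> (\<lambda>p. residual a p * kernel_K c lam h (feature p))"
      using that slope_integrable by auto
    have "slope b h - slope a h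
        = (\<integral>p. residual b p * kernel_K c lam h (feature p) - residual a p * kernel_K c lam h (feature p) \<partial>\<mu>)"
      unfolding slope_def using int by (rule Bochner_Integration.integral_diff[symmetric])
    also have "\<bar>\<dots>\<bar> \<le> K * \<bar>b - a\<bar> * (?B * N h)"
    proof (rule AE_integral_le)
      fix p assume p: "p \<in> support_set"
      show "\<bar>residual b p * kernel_K c lam h (feature p) - residual a p * kernel_K c lam h (feature p)\<bar>
          \<le> K * \<bar>b - a\<bar> * (?B * N h)"
        unfolding left_diff_distrib[symmetric] abs_mult
        using inc[OF that p] kernel_feature_le[OF p] K by (intro mult_mono) auto
    qed (use int in auto)
    finally show ?thesis .
  qed
  \<comment> \<open>\<alpha> times the Lipschitz constant \<open>K * (?B * ?B)\<close> of the slope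
    at features.\<close>
  define C2 where "C2 = \<alpha> * (K * (?B * ?B))"
  have C2: "0 \<le> C2" using \<alpha> K B by (simp add: C2_def)
  \<comment> \<open>The base point \<open>t\<close> may be anywhere in \<open>{a..b}\<close>:
    \<open>t = a\<close> yields the expansion forward in time and \<open>t = b\<close> the one
    backward.\<close>
  have lin': "\<bar>residual b p - residual a p + \<alpha> * slope t (feature p) * (b - a)\<bar> \<le> C2 * (b - a)\<^sup>2"
    if "0 \<le> a" "a \<le> b" "b \<le> T" "t \<in> {a..b}" "p \<in> support_set" for a b t p
  proof -
    let ?E = "K * (b - a) * (?B * ?B)"
    have "\<bar>slope s (feature p) - slope t (feature p)\<bar> \<le> ?E" if s: "a \<le> s" "s \<le> b" for s
    proof -
      have "\<bar>slope s (feature p) - slope t (feature p)\<bar> \<le> K * \<bar>s - t\<bar> * (?B * N (feature p))"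
        using slope_inc[of t s "feature p"] s that
          \<open>0 \<le> a\<close> \<open>b \<le> T\<close> \<open>t \<in> {a..b}\<close> by auto
      also have "\<dots> \<le> ?E"
        using s \<open>t \<in> {a..b}\<close> K B N_nonneg N_feature_le[OF \<open>p \<in> support_set\<close>]
        by (intro mult_mono) auto
      finally show ?thesis .
    qed
    moreover have "0 \<le> ?E" using K B that by simp
    ultimately have "\<bar>blinfun_apply (g b) (feature p) - blinfun_apply (g a) (feature p)
        + \<alpha> * slope t (feature p) * (b - a)\<bar> \<le> \<alpha> * ?E * (b - a)"
      using that by (intro flow_increment_le) auto
    then show ?thesis
      by (simp add: residual_def C2_def power2_eq_square mult_ac)
  qed
  have lin: "\<bar>residual s p - residual t p + \<alpha> * slope t (feature p) * (s - t)\<bar> \<le> C2 * (s - t)\<^sup>2"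
    if "s \<in> {0..T}" "t \<in> {0..T}" "p \<in> support_set" for s t p
  proof (cases "t \<le> s")
    case True
    then show ?thesis using lin'[of t s t p] that by auto
  next
    case False
    then have "\<bar>residual t p - residual s p + \<alpha> * slope t (feature p) * (t - s)\<bar> \<le> C2 * (t - s)\<^sup>2"
      using lin'[of s t t p] that by auto
    moreover have "residual t p - residual s p + \<alpha> * slope t (feature p) * (t - s)
        = - (residual s p - residual t p + \<alpha> * slope t (feature p) * (s - t))"
      by (simp add: algebra_simps)
    ultimately show ?thesis
      by (simp only: abs_minus power2_commute[of s t])
  qed
  show ?thesis
  proof (rule exI[of _ R], rule exI[of _ "max K (R * ?B * ?B)"], rule exI[of _ C2], safe)
    show "0 \<le> max K (R * ?B * ?B)" using K by simp
    fix s t p assume *: "s \<in> {0..T}" "t \<in> {0..T}" "p \<in> support_set"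
    show "\<bar>residual t p\<bar> \<le> R" using R(2) * by blast
    show "\<bar>slope t (feature p)\<bar> \<le> max K (R * ?B * ?B)"
      using slope_feature * by (simp add: le_max_iff_disj)
    have "K * \<bar>s - t\<bar> \<le> max K (R * ?B * ?B) * \<bar>s - t\<bar>" by (intro mult_right_mono) auto
    then show "\<bar>residual s p - residual t p\<bar> \<le> max K (R * ?B * ?B) * \<bar>s - t\<bar>"
      using inc * by (meson order_trans)
    show "\<bar>residual s p - residual t p + \<alpha> * slope t (feature p) * (s - t)\<bar> \<le> C2 * (s - t)\<^sup>2"
      using lin * by blast
  qed (use R(1) C2 in auto)
qed

text \<open>Unfolding \<open>slope\<close> gives the quadratic form of the kernel at the residual,
  to which \<open>feature_kernel_nonneg\<close> applies.\<close>

lemma residual_slope_nonneg: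
  assumes "0 \<le> t"
  shows "0 \<le> (\<integral>p. residual t p * slope t (feature p) \<partial>\<mu>)"
proof -
  obtain R where R: "0 \<le> R" "\<And>p. p \<in> support_set \<Longrightarrow> \<bar>residual t p\<bar> \<le> R"
    using residual_bounded[of t] assms by auto
  \<comment> \<open>The residual is bounded on \<open>support_set\<close>, whereas
    \<open>feature_kernel_nonneg\<close> asks for bounds at every \<open>p\<close>; the cut-off
    version agrees with it almost everywhere.\<close>
  define r where "r p = indicator support_set p * residual t p" for p
  \<comment> \<open>Pairing the value with \<open>sqrt c\<close> times the gradient makes the inner
    product of two features the integrand of \<open>kernel_K\<close>, weighted by
    \<open>r p * r q\<close>.\<close>
  define \<Phi> where "\<Phi> p w = r p *\<^sub>R (apply_c2b (feature p) w, sqrt c *\<^sub>R grad (apply_c2b (feature p)) w)" for p w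
  have [measurable]: "residual t \<in> borel_measurable \<mu>"
    by (rule measurable_flow_feature[OF assms])
  have [measurable]: "support_set \<in> sets \<mu>"
    unfolding sets_\<mu> by (rule borel_closed[OF closed_support])
  have r_meas[measurable]: "r \<in> borel_measurable \<mu>"
    unfolding r_def[abs_def] by measurable
  have \<Phi>_inner: "(\<integral>w. \<Phi> p w \<bullet> \<Phi> q w \<partial>lam) = r p * (r q * kernel_K c lam (feature p) (feature q))" for p q
  proof -
    have "\<Phi> p w \<bullet> \<Phi> q w = (r p * r q) * (apply_c2b (feature p) w * apply_c2b (feature q) w
        + c * (grad (apply_c2b (feature p)) w \<bullet> grad (apply_c2b (feature q)) w))" for w
    proof -
      have "sqrt c * (sqrt c * v) = c * v" for v using c by (simp add: mult.assoc[symmetric])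
      then show ?thesis by (simp add: \<Phi>_def algebra_simps)
    qed
    then show ?thesis by (simp add: kernel_K_def mult.assoc)
  qed
  have "0 \<le> (\<integral>p. (\<integral>q. (\<integral>w. \<Phi> p w \<bullet> \<Phi> q w \<partial>lam) \<partial>\<mu>) \<partial>\<mu>)"
  proof (rule feature_kernel_nonneg[OF \<mu> lam])
    have sets_pair: "sets (\<mu> \<Otimes>\<^sub>M lam) = sets borel"
      by (subst borel_prod[symmetric]) (rule sets_pair_measure_cong[OF sets_\<mu> sets_lam])
    \<comment> \<open>Joint measurability in \<open>(p, w)\<close> is read off the explicit formulas
      for the ridge function and its gradient, which are continuous in both variables.\<close>
    have "continuous_on UNIV (\<lambda>q :: ('a \<times> 'b \<times> real \<times> real) \<times> 'a.
        (\<sigma> (snd q \<bullet> fst (fst q) + snd (snd (snd (fst q)))),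
         sqrt c *\<^sub>R (partial_deriv 1 \<sigma> (snd q \<bullet> fst (fst q) + snd (snd (snd (fst q)))) *\<^sub>R fst (fst q))))"
      by (intro continuous_intros continuous_on_compose2[OF continuous_on_activation(1)[OF \<sigma>]]
          continuous_on_compose2[OF continuous_on_activation(2)[OF \<sigma>]]) auto
    then have [measurable]: "(\<lambda>q :: ('a \<times> 'b \<times> real \<times> real) \<times> 'a.
        (\<sigma> (snd q \<bullet> fst (fst q) + snd (snd (snd (fst q)))),
         sqrt c *\<^sub>R (partial_deriv 1 \<sigma> (snd q \<bullet> fst (fst q) + snd (snd (snd (fst q)))) *\<^sub>R fst (fst q))))
        \<in> borel_measurable (\<mu> \<Otimes>\<^sub>M lam)"
      unfolding measurable_cong_sets[OF sets_pair refl] by (rule borel_measurable_continuous_onI)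
    have \<Phi>_eq: "case_prod \<Phi> = (\<lambda>q. r (fst q) *\<^sub>R (\<sigma> (snd q \<bullet> fst (fst q) + snd (snd (snd (fst q)))),
         sqrt c *\<^sub>R (partial_deriv 1 \<sigma> (snd q \<bullet> fst (fst q) + snd (snd (snd (fst q)))) *\<^sub>R fst (fst q))))"
      by (simp add: fun_eq_iff \<Phi>_def feature_def case_prod_unfold grad_ridge[OF \<sigma>])
        (simp add: apply_ridge[OF \<sigma>])
    show "case_prod \<Phi> \<in> borel_measurable (\<mu> \<Otimes>\<^sub>M lam)"
      unfolding \<Phi>_eq by (intro borel_measurable_scaleR) measurable
    let ?A = "c2_norm \<sigma>"
    show "norm (\<Phi> p w) \<le> R * (?A + sqrt c * (?A * Cx))" for p w
    proof (cases "p \<in> support_set")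
      case True
      obtain x z y u where p_eq: "p = (x, z, y, u)" by (metis surj_pair)
      have x: "norm x \<le> Cx" using True by (simp add: p_eq support_set_def)
      have A: "0 \<le> ?A" by (rule c2_norm_activation_nonneg[OF \<sigma>])
      have "norm (grad (apply_c2b (feature p)) w) \<le> ?A * Cx"
        using ridge_bounds(2)[OF \<sigma>, of x u w] mult_left_mono[OF x A] by (simp add: feature_def p_eq)
      then have "norm (sqrt c *\<^sub>R grad (apply_c2b (feature p)) w) \<le> sqrt c * (?A * Cx)"
        using c by (simp add: mult_left_mono)
      moreover have "norm (apply_c2b (feature p) w) \<le> ?A"
        using ridge_bounds(1)[OF \<sigma>, of x u w] by (simp add: feature_def p_eq)
      ultimately have "norm (apply_c2b (feature p) w, sqrt c *\<^sub>R grad (apply_c2b (feature p)) w)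
          \<le> ?A + sqrt c * (?A * Cx)"
        by (intro order_trans[OF norm_Pair_le] add_mono)
      moreover have "\<bar>r p\<bar> \<le> R" using R True by (simp add: r_def)
      ultimately show ?thesis
        unfolding \<Phi>_def norm_scaleR using R(1) by (intro mult_mono) auto
    next
      case False
      have "0 \<le> ?A" by (rule c2_norm_activation_nonneg[OF \<sigma>])
      then show ?thesis using False R(1) c Cx by (simp add: \<Phi>_def r_def)
    qed
  qed
  also have "\<dots> = (\<integral>p. residual t p * slope t (feature p) \<partial>\<mu>)"
  proof -
    have inner: "(\<integral>q. (\<integral>w. \<Phi> p w \<bullet> \<Phi> q w \<partial>lam) \<partial>\<mu>) = r p * slope t (feature p)" for p
    proof -
      have "(\<integral>q. r q * kernel_K c lam (feature p) (feature q) \<partial>\<mu>) = slope t (feature p)"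
        unfolding slope_def
      proof (rule integral_cong_AE)
        show m: "(\<lambda>q. residual t q * kernel_K c lam (feature p) (feature q)) \<in> borel_measurable \<mu>"
          using slope_integrable[OF assms] by (rule borel_measurable_integrable)
        \<comment> \<open>\<open>slope_integrable\<close> provides measurability of the residual
          times the kernel, so the indicator is multiplied onto that product as a whole.\<close>
        have "(\<lambda>q. indicator support_set q * (residual t q * kernel_K c lam (feature p) (feature q)))
            \<in> borel_measurable \<mu>"
          using m by measurable
        then show "(\<lambda>q. r q * kernel_K c lam (feature p) (feature q)) \<in> borel_measurable \<mu>"
          by (simp add: r_def mult.assoc)
        show "AE q in \<mu>. r q * kernel_K c lam (feature p) (feature q)
            = residual t q * kernel_K c lam (feature p) (feature q)"
          using AE_support by eventually_elim (simp add: r_def)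
      qed
      then show ?thesis by (simp add: \<Phi>_inner)
    qed
    have [measurable]: "(\<lambda>p. slope t (feature p)) \<in> borel_measurable \<mu>"
      by (rule measurable_flow_feature[OF assms])
    have "AE p in \<mu>. r p * slope t (feature p) = residual t p * slope t (feature p)"
      using AE_support by eventually_elim (simp add: r_def)
    then show ?thesis
      unfolding inner by (intro integral_cong_AE) measurable
  qed
  finally show ?thesis .
qed

section \<open>Differentiating the loss\<close>

lemma integrable_support_bounded:
  fixes F :: "'a \<times> 'b \<times> real \<times> real \<Rightarrow> real"
  assumes "F \<in> borel_measurable \<mu>" "\<And>p. p \<in> support_set \<Longrightarrow> \<bar>F p\<bar> \<le> B"
  shows "integrable \<mu> F"
  using assms AE_support by (intro \<mu>.integrable_const_bound[where B = B]) (auto elim: eventually_mono)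

lemma integrable_residual_sq:
  assumes "0 \<le> t"
  shows "integrable \<mu> (\<lambda>p. (residual t p)\<^sup>2)"
proof -
  obtain R where R: "\<forall>s\<in>{0..t}. \<forall>p\<in>support_set. \<bar>residual s p\<bar> \<le> R"
    using residual_bounded by blast
  have "\<bar>(residual t p)\<^sup>2\<bar> \<le> R\<^sup>2" if "p \<in> support_set" for p
    using R that assms power_mono[of "\<bar>residual t p\<bar>" R 2] by auto
  then show ?thesis
    using measurable_flow_feature(1)[OF assms] by (intro integrable_support_bounded[where B = "R\<^sup>2"]) auto
qed

lemma loss_has_derivative:
  assumes "0 \<le> t"
  shows "((\<lambda>s. 1 / 2 * (\<integral>p. (residual s p)\<^sup>2 \<partial>\<mu>)) has_real_derivative
    - \<alpha> * (\<integral>p. residual t p * slope t (feature p) \<partial>\<mu>)) (at t within {0..})"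
proof -
  \<comment> \<open>The horizon \<open>t + 1\<close> leaves room to the right of
    \<open>t\<close>.\<close>
  obtain R C1 C2 where nonneg: "0 \<le> C1" "0 \<le> C2" "0 \<le> R"
    and bounds: "\<forall>s\<in>{0..t+1}. \<forall>t\<in>{0..t+1}. \<forall>p\<in>support_set.
      \<bar>residual t p\<bar> \<le> R \<and> \<bar>slope t (feature p)\<bar> \<le> C1 \<and>
      \<bar>residual s p - residual t p\<bar> \<le> C1 * \<bar>s - t\<bar> \<and>
      \<bar>residual s p - residual t p + \<alpha> * slope t (feature p) * (s - t)\<bar> \<le> C2 * (s - t)\<^sup>2"
    using flow_linearization[of "t + 1"] assms by fastforce
  have t: "t \<in> {0..t+1}" using assms by simp
  have bd: "\<bar>residual t p\<bar> \<le> R" "\<bar>slope t (feature p)\<bar> \<le> C1"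
      "s \<in> {0..t+1} \<Longrightarrow> \<bar>residual s p - residual t p\<bar> \<le> C1 * \<bar>s - t\<bar>"
      "s \<in> {0..t+1} \<Longrightarrow>
        \<bar>residual s p - residual t p + \<alpha> * slope t (feature p) * (s - t)\<bar> \<le> C2 * (s - t)\<^sup>2"
    if "p \<in> support_set" for s p
    using bounds t that by blast+
  note [measurable] = measurable_flow_feature[OF assms]
  have int_rs: "integrable \<mu> (\<lambda>p. residual t p * slope t (feature p))"
  proof (rule integrable_support_bounded)
    fix p assume "p \<in> support_set"
    then show "\<bar>residual t p * slope t (feature p)\<bar> \<le> R * C1"
      unfolding abs_mult using bd(1,2) nonneg by (intro mult_mono) auto
  qed measurable
  show ?thesis
  \<comment> \<open>\<open>R * C2\<close> bounds the residual times its linearization error;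
    \<open>C1\<^sup>2 / 2\<close> bounds half the squared increment left over from expanding the
    square.\<close>
  proof (rule has_real_derivative_quadratic_remainder[where T = "t + 1" and C = "R * C2 + C1\<^sup>2 / 2"])
    fix s assume "s \<in> {0..}" "s < t + 1"
    then have s: "s \<in> {0..t+1}" "0 \<le> s" by auto
    note [measurable] = measurable_flow_feature[OF s(2)]
    let ?rem = "\<lambda>p. 1 / 2 * (residual s p)\<^sup>2 - 1 / 2 * (residual t p)\<^sup>2
        + \<alpha> * (s - t) * (residual t p * slope t (feature p))"
    have "1 / 2 * (\<integral>p. (residual s p)\<^sup>2 \<partial>\<mu>) - 1 / 2 * (\<integral>p. (residual t p)\<^sup>2 \<partial>\<mu>)
        - - \<alpha> * (\<integral>p. residual t p * slope t (feature p) \<partial>\<mu>) * (s - t) = (\<integral>p. ?rem p \<partial>\<mu>)"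
      using int_rs integrable_residual_sq[OF s(2)] integrable_residual_sq[OF assms] by simp
    also have "\<bar>\<dots>\<bar> \<le> (R * C2 + C1\<^sup>2 / 2) * (s - t)\<^sup>2"
    proof (rule AE_integral_le)
      show "integrable \<mu> ?rem"
        using int_rs integrable_residual_sq[OF s(2)] integrable_residual_sq[OF assms] by simp
      fix p assume p: "p \<in> support_set"
      let ?\<rho> = "residual s p - residual t p + \<alpha> * slope t (feature p) * (s - t)"
      have "?rem p = residual t p * ?\<rho> + (residual s p - residual t p)\<^sup>2 / 2"
        by (simp add: power2_eq_square field_simps)
      moreover have "\<bar>residual t p * ?\<rho>\<bar> \<le> R * (C2 * (s - t)\<^sup>2)"
        unfolding abs_mult using bd(1)[OF p] bd(4)[OF p s(1)] nonneg by (intro mult_mono) auto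
      moreover have "(residual s p - residual t p)\<^sup>2 \<le> (C1 * \<bar>s - t\<bar>)\<^sup>2"
        using power_mono[OF bd(3)[OF p s(1)], of 2] by simp
      moreover have "(C1 * \<bar>s - t\<bar>)\<^sup>2 = C1\<^sup>2 * (s - t)\<^sup>2"
        by (simp add: power_mult_distrib)
      moreover have "(R * C2 + C1\<^sup>2 / 2) * (s - t)\<^sup>2 = R * (C2 * (s - t)\<^sup>2) + C1\<^sup>2 * (s - t)\<^sup>2 / 2"
        by (simp add: algebra_simps)
      moreover have "0 \<le> (residual s p - residual t p)\<^sup>2" by simp
      ultimately show "\<bar>?rem p\<bar> \<le> (R * C2 + C1\<^sup>2 / 2) * (s - t)\<^sup>2"
        by linarith
    qed
    finally show "\<bar>1 / 2 * (\<integral>p. (residual s p)\<^sup>2 \<partial>\<mu>) - 1 / 2 * (\<integral>p. (residual t p)\<^sup>2 \<partial>\<mu>)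
        - - \<alpha> * (\<integral>p. residual t p * slope t (feature p) \<partial>\<mu>) * (s - t)\<bar>
        \<le> (R * C2 + C1\<^sup>2 / 2) * (s - t)\<^sup>2" .
  qed simp
qed

end

section \<open>Descent of the loss under the stationary law of the memory chain\<close>

theorem proposition3p5:
  fixes M :: "'w measure"
    and X :: "nat \<Rightarrow> 'w \<Rightarrow> real ^ 'd"
    and Z :: "nat \<Rightarrow> 'w \<Rightarrow> real ^ 'dz"
    and \<eta> :: "nat \<Rightarrow> 'w \<Rightarrow> real ^ 'de"
    and Y u :: "nat \<Rightarrow> 'w \<Rightarrow> real"
    and P :: "(real ^ 'd) \<times> (real ^ 'dz) \<Rightarrow> ((real ^ 'd) \<times> (real ^ 'dz)) measure"
    and f :: "(real ^ 'd) \<times> (real ^ 'dz) \<times> (real ^ 'de) \<Rightarrow> real"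
    and \<sigma> :: "real \<Rightarrow> real"
    and lam :: "(real ^ 'd) measure"
    and \<mu> :: "((real ^ 'd) \<times> (real ^ 'dz) \<times> real \<times> real) measure"
    and g :: "real \<Rightarrow> (real ^ 'd) c2b \<Rightarrow>\<^sub>L real"
    and \<alpha> \<mu>c2 L Cx \<mu>w2 \<mu>b Kb C\<sigma> :: real
  assumes "prob_space M"
    and "\<alpha> > 0" and "\<mu>c2 > 0"
    and XZ_markov: "markov_chain M borel (\<lambda>k \<omega>. (X k \<omega>, Z k \<omega>)) P"
    and eta_indep: "prob_space.indep_vars M (\<lambda>_. borel) \<eta> UNIV"
    and eta_ident: "\<And>k. distr M borel (\<eta> k) = distr M borel (\<eta> 0)"
    and eta_XZ_indep: "prob_space.indep_set M
          (path_events M borel (\<lambda>k \<omega>. (X k \<omega>, Z k \<omega>))) (path_events M borel \<eta>)"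
    and Y: "\<And>k \<omega>. Y k \<omega> = f (X k \<omega>, Z k \<omega>, \<eta> k \<omega>)"
    and "0 \<le> L" and "L < 1"
    and P_contr: "\<And>p q. wasserstein2 (P p) (P q) \<le> ennreal (L * dist p q)"
    and XZ_bounded: "\<And>k. AE \<omega> in M. norm (X k \<omega>, Z k \<omega>) \<le> Cx"
    and eta_moment: "\<And>k. integrable M (\<lambda>\<omega>. (norm (\<eta> k \<omega>))\<^sup>2)"
    and f_bounded: "bounded (range f)"
    and f_lipschitz: "\<exists>K. K-lipschitz_on UNIV f"
    and \<sigma>: "\<sigma> \<in> C2b"
    and C\<sigma>: "C\<sigma> = (SUP t. \<bar>deriv \<sigma> t\<bar>)"
    and lam_prob: "prob_space lam" and lam_sets: "sets lam = sets borel"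
    and lam_ac: "absolutely_continuous lborel lam"
    and lam_moment: "has_bochner_integral lam (\<lambda>w. (norm w)\<^sup>2) \<mu>w2" and "\<mu>w2 > 0"
    and "\<mu>b > 0" and "\<mu>b \<le> Kb" and "2 * Kb\<^sup>2 * C\<sigma>\<^sup>2 < 1"
    and q0: "sqrt (max (L\<^sup>2 + 2 * \<mu>b\<^sup>2 * \<mu>w2 * C\<sigma>\<^sup>2) (2 * \<mu>b\<^sup>2 * C\<sigma>\<^sup>2)) < 1"
    and u_0: "\<And>\<omega>. u 0 \<omega> = 0"
    and u_Suc: "\<And>k \<omega>. u (Suc k) \<omega> = \<mu>b * (\<integral>w. \<sigma> (w \<bullet> X k \<omega> + u k \<omega>) \<partial>lam)"
    and H_markov: "markov_chain M borel (\<lambda>k \<omega>. (X k \<omega>, Z k \<omega>, Y k \<omega>, u k \<omega>))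
          (memory_kernel P (distr M borel (\<eta> 0)) f \<mu>b \<sigma> lam)"
    and \<mu>: "stationary_distribution borel
          (memory_kernel P (distr M borel (\<eta> 0)) f \<mu>b \<sigma> lam) \<mu>"
    and g: "flow_solution \<alpha> \<mu>c2 lam \<sigma> \<mu> g"
  shows "\<forall>t\<ge>0.
    integrable \<mu> (\<lambda>(x, z, y, v). (blinfun_apply (g t) (ridge \<sigma> x v) - y)\<^sup>2) \<and>
    (\<exists>D\<le>0. ((\<lambda>s. 1 / 2 * (\<integral>(x, z, y, v). (blinfun_apply (g s) (ridge \<sigma> x v) - y)\<^sup>2 \<partial>\<mu>))
        has_real_derivative D) (at t within {0..}))"
proof (intro allI impI)
  fix t :: real assume t: "0 \<le> t"
  interpret M: prob_space M by fact
  have P: "P \<in> borel \<rightarrow>\<^sub>M prob_algebra borel"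
    using XZ_markov by (simp add: markov_chain_def)
  have H: "memory_kernel P (distr M borel (\<eta> 0)) f \<mu>b \<sigma> lam \<in> borel \<rightarrow>\<^sub>M prob_algebra borel"
    using H_markov by (simp add: markov_chain_def)
  have "\<eta> 0 \<in> M \<rightarrow>\<^sub>M borel"
    using eta_indep by (simp add: M.indep_vars_def)
  then have \<nu>: "prob_space (distr M borel (\<eta> 0))" "sets (distr M borel (\<eta> 0)) = sets borel"
    by (simp_all add: M.prob_space_distr)
  have f: "f \<in> borel_measurable borel"
    using f_lipschitz by (auto intro: borel_measurable_continuous_onI lipschitz_on_continuous_on)
  obtain Cy where Cy: "\<And>v. \<bar>f v\<bar> \<le> Cy"
    using f_bounded by (auto simp: bounded_iff)
  have prob_\<mu>: "prob_space \<mu>" and sets_\<mu>: "sets \<mu> = sets borel"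
    using \<mu> by (auto simp: stationary_distribution_def space_prob_algebra)
  have pr: "(\<lambda>(x :: real ^ 'd, z :: real ^ 'dz, y :: real, u :: real). (x, z)) \<in> \<mu> \<rightarrow>\<^sub>M borel"
    unfolding measurable_cong_sets[OF sets_\<mu> refl] case_prod_unfold
    by (intro borel_measurable_continuous_onI continuous_intros)
  \<comment> \<open>The \<open>(x, z)\<close> marginal of \<mu> is stationary for \<open>P\<close>,
    so the contraction carries the almost sure bound on the chain over to it.\<close>
  have "AE p in distr \<mu> borel (\<lambda>(x, z, y, u). (x, z)). norm p \<le> Cx"
    by (rule AE_stationary_norm_le[OF \<open>prob_space M\<close> XZ_markov XZ_bounded \<open>0 \<le> L\<close> \<open>L < 1\<close> P_contr
          stationary_memory_kernel_marginal[OF P \<nu> f H \<mu>]])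
  from AE_distrD[OF pr this] AE_stationary_memory_kernel_output[OF P \<nu> f H \<mu> Cy]
  \<comment> \<open>The norm of \<open>x\<close> is at most that of the pair \<open>(x, z)\<close>;
    the absolute value of \<open>Cx\<close> supplies the nonnegative radius that
    \<open>memory_flow\<close> asks for.\<close>
  have supp: "AE (x, z, y, u) in \<mu>. norm x \<le> \<bar>Cx\<bar> \<and> \<bar>y\<bar> \<le> Cy"
  proof eventually_elim
    case (elim p)
    then show ?case
      using norm_fst_le[of "fst p" "fst (snd p)"] by (simp add: case_prod_unfold)
  qed
  interpret memory_flow \<alpha> \<mu>c2 "\<bar>Cx\<bar>" Cy lam \<sigma> \<mu> g
    by (rule memory_flow.intro; (fact | rule abs_ge_zero))
  have eq: "(\<lambda>(x, z, y, v). (blinfun_apply (g s) (ridge \<sigma> x v) - y)\<^sup>2) = (\<lambda>p. (residual s p)\<^sup>2)" for s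
    by (auto simp: residual_def feature_def label_def)
  have "- \<alpha> * (\<integral>p. residual t p * slope t (feature p) \<partial>\<mu>) \<le> 0"
    using residual_slope_nonneg[OF t] \<alpha> by (simp add: mult_nonneg_nonneg)
  with integrable_residual_sq[OF t] loss_has_derivative[OF t]
  show "integrable \<mu> (\<lambda>(x, z, y, v). (blinfun_apply (g t) (ridge \<sigma> x v) - y)\<^sup>2) \<and>
    (\<exists>D\<le>0. ((\<lambda>s. 1 / 2 * (\<integral>(x, z, y, v). (blinfun_apply (g s) (ridge \<sigma> x v) - y)\<^sup>2 \<partial>\<mu>))
        has_real_derivative D) (at t within {0..}))"
    unfolding eq by blast
qed

end
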